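(* Let $P$ be a finite ranked poset with least and greatest elements, and let $b(P)=\sum_{x\in P}\operatorname{rank}x$. There exists a constant $c>0$ so that if $n\ge\operatorname{rank}P$, then $$2^{\binom{n}{\lfloor n/2\rfloor}}\le|\mathrm{Quilts}(P,B_n)|\le2^{\,b(P)\left(1+c\ln n/\sqrt n\right)\binom{n}{\lfloor n/2\rfloor}}.$$ If $n\ge2\operatorname{rank}P$, we have the improved lower bound $$|\mathrm{Quilts}(P,B_n)|\ge d_1(P)^{\binom{n}{\lfloor n/2\rfloor}}.$$ In particular, $$2^{\binom{k}{\lfloor k/2\rfloor}\binom{n}{\lfloor n/2\rfloor}}\le|\mathrm{Quilts}(B_k,B_n)|\le2^{\,k2^{k-1}\left(1+c\ln n/\sqrt n\right)\binom{n}{\lfloor n/2\rfloor}}$$ for $n\ge2k$.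
   Context: $\mathbb N=\{0,1,2,\dots\}$. A poset is ranked if all its maximal chains have the same size; $\hat 0,\hat 1$ denote least and greatest elements; $x\lessdot y$ means $y$ covers $x$; the rank function satisfies $\operatorname{rank}\hat 0=0$ and $\operatorname{rank}y=\operatorname{rank}x+1$ if $x\lessdot y$; $\operatorname{rank}P=\operatorname{rank}\hat 1_P$. $P\times Q$ carries the product order. $B_n$ ($n\geq 1$) is the Boolean lattice of subsets of $\{1,\dots,n\}$ ordered by inclusion; it has rank $n$. A quilt of type $(P,Q)$, for finite ranked posets $P,Q$ with least and greatest elements, is a map $f:P\times Q\to\mathbb N$ such that: (i) $f(x,y)=0$ whenever $x=\hat 0_P$ or $y=\hat 0_Q$; (ii) $f(\hat 1_P,\hat 1_Q)=\min\{\operatorname{rank}P,\operatorname{rank}Q\}$; (iii) if $(x,y)\lessdot(x',y')$ in $P\times Q$, then $f(x',y')\in\{f(x,y),f(x,y)+1\}$. $\mathrm{Quilts}(P,Q)$ is the set of all quilts of type $(P,Q)$. $d_1(P)$ is the number of surjective maps $f:P\to\{0,1\}$ with $f(y)\in\{f(x),f(x)+1\}$ whenever $x\lessdot y$.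
   Formalization: The first lower bound is stated only for rank P ≥ 1 and n ≥ 2; it is false otherwise: if P is a single point, or if n = 1 (so P has at most two elements), there is exactly one quilt, while the claim would require at least two. *)

theory Defs
  imports Complex_Main "HOL-Library.FuncSet" "HOL-Library.Product_Order"
begin

text \<open>
  A poset is a set \<open>P\<close> of elements of a type of class \<^class>\<open>order\<close>, with the order of the type
  restricted to \<open>P\<close>.  So \<open>P \<times> Q\<close> is the product poset, and a family of sets is ordered by inclusion.
\<close>

definition finite_ranked_poset :: "'a::order set \<Rightarrow> bool" where
  "finite_ranked_poset P \<longleftrightarrow>
     finite P \<and>
     (\<forall>C D. pred_on.maxchain P (<) C \<and> pred_on.maxchain P (<) D \<longrightarrow> card C = card D) \<and>
     (\<exists>x\<in>P. \<forall>y\<in>P. x \<le> y) \<and> (\<exists>x\<in>P. \<forall>y\<in>P. y \<le> x)"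

definition poset_bot :: "'a::order set \<Rightarrow> 'a" where
  "poset_bot P = (LEAST x. x \<in> P)"

definition poset_top :: "'a::order set \<Rightarrow> 'a" where
  "poset_top P = (GREATEST x. x \<in> P)"

definition covered_by :: "'a::order set \<Rightarrow> 'a \<Rightarrow> 'a \<Rightarrow> bool" where
  "covered_by P x y \<longleftrightarrow> x \<in> P \<and> y \<in> P \<and> x < y \<and> \<not> (\<exists>z\<in>P. x < z \<and> z < y)"

text \<open>
  The two defining equations determine the rank function on a finite ranked poset with a least
  element; the value 0 outside \<open>P\<close> only serves to make it unique as a function on the whole type.
\<close>

definition elem_rank :: "'a::order set \<Rightarrow> 'a \<Rightarrow> nat" where
  "elem_rank P = (THE r. r (poset_bot P) = 0 \<and>
                         (\<forall>x y. covered_by P x y \<longrightarrow> r y = r x + 1) \<and>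
                         (\<forall>x. x \<notin> P \<longrightarrow> r x = 0))"

definition poset_rank :: "'a::order set \<Rightarrow> nat" where
  "poset_rank P = elem_rank P (poset_top P)"

definition boolean_lattice :: "nat \<Rightarrow> nat set set" where
  "boolean_lattice n = Pow {1..n}"

text \<open>
  Maps out of a poset are taken extensional (\<^const>\<open>undefined\<close> outside the carrier), so that
  distinct elements of the following two sets are distinct maps on the carrier.
\<close>

definition quilts :: "'a::order set \<Rightarrow> 'b::order set \<Rightarrow> ('a \<times> 'b \<Rightarrow> nat) set" where
  "quilts P Q =
     {f \<in> (P \<times> Q) \<rightarrow>\<^sub>E UNIV.
        (\<forall>x\<in>P. \<forall>y\<in>Q. x = poset_bot P \<or> y = poset_bot Q \<longrightarrow> f (x, y) = 0) \<and>
        f (poset_top P, poset_top Q) = min (poset_rank P) (poset_rank Q) \<and>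
        (\<forall>p q. covered_by (P \<times> Q) p q \<longrightarrow> f q \<in> {f p, f p + 1})}"

definition d1 :: "'a::order set \<Rightarrow> nat" where
  "d1 P = card {f \<in> P \<rightarrow>\<^sub>E {0, 1 :: nat}.
                  f ` P = {0, 1} \<and>
                  (\<forall>x y. covered_by P x y \<longrightarrow> f y \<in> {f x, f x + 1})}"

definition rank_sum :: "'a::order set \<Rightarrow> nat" where
  "rank_sum P = (\<Sum>x\<in>P. elem_rank P x)"

end

theory Submission
  imports Defs "HOL-Combinatorics.Multiset_Permutations"
begin

text \<open>
  A quilt \<open>f\<close> satisfies \<open>f (x, y) \<le> rank x\<close>, so it amounts to \<open>rank x\<close> upsets of \<open>B\<^sub>n\<close> for every \<open>x\<close>.
  Hence the upper bounds, with an absolute constant, reduce to Kleitman's bound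
  \<open>2 powr ((1 + c * ln n / sqrt n) * C)\<close>, \<open>C = n choose (n div 2)\<close>, for the number of upsets, that is
  for the number of independent sets of the comparability graph on \<open>B\<^sub>n\<close>.  If a family of sets
  other than the empty and the full one has all degrees at most \<open>D\<close> in this graph, then averaging
  over maximal chains shows that it has at most \<open>C / (1 - 2 * D / n)\<close> members.  So larger families
  have vertices of large degree, and branching on these keeps the number of independent sets small.

  For the lower bounds, quilts are constructed that depend on \<open>y\<close> only through \<open>card y\<close>, except on
  the middle layer of \<open>B\<^sub>n\<close>, where they can be chosen freely and independently.
\<close>

section \<open>Graded posets and their products\<close>

text \<open>The rank function and the bounds are parameters, so that proofs avoid the definite
  descriptions behind \<open>elem_rank\<close>, \<open>poset_bot\<close> and
  \<open>poset_top\<close>; \<open>rank_outside\<close> makes \<open>r\<close> equal to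
  \<open>elem_rank P\<close> on the whole type.\<close>

locale graded =
  fixes P :: "'a::order set" and r :: "'a \<Rightarrow> nat" and z t :: 'a
  assumes finite: "finite P"
    and z_in: "z \<in> P" and t_in: "t \<in> P"
    and z_le: "x \<in> P \<Longrightarrow> z \<le> x" and le_t: "x \<in> P \<Longrightarrow> x \<le> t"
    and rank_z: "r z = 0"
    and rank_cover: "covered_by P x y \<Longrightarrow> r y = r x + 1"
    and rank_outside: "x \<notin> P \<Longrightarrow> r x = 0"
begin

lemma bot_eq: "poset_bot P = z"
  unfolding poset_bot_def by (rule Least_equality) (auto intro: z_in z_le)

lemma top_eq: "poset_top P = t"
  unfolding poset_top_def by (rule Greatest_equality) (auto intro: t_in le_t)

lemma ex_lower_cover:
  assumes "x \<in> P" "y \<in> P" "x < y"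
  obtains w where "covered_by P w y" "x \<le> w"
proof -
  let ?S = "{w \<in> P. x \<le> w \<and> w < y}"
  have "finite ?S" "x \<in> ?S" using finite assms by auto
  then obtain w where w: "w \<in> ?S" "x \<le> w" "\<And>v. v \<in> ?S \<Longrightarrow> w \<le> v \<Longrightarrow> w = v"
    using finite_has_maximal2[of ?S x] by blast
  have "covered_by P w y"
    unfolding covered_by_def
  proof (intro conjI notI)
    assume "\<exists>v\<in>P. w < v \<and> v < y"
    then obtain v where "v \<in> P" "w < v" "v < y" by blast
    moreover have "x \<le> v" using \<open>w < v\<close> w(2) by (meson order.trans order.strict_implies_order)
    ultimately show False using w(3)[of v] by (simp add: less_le_not_le)
  qed (use w assms in auto)
  then show thesis using that w by blast
qed

lemma wf_less: "wf {(a, b). a \<in> P \<and> b \<in> P \<and> a < b}"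
proof (rule wf_subset[OF wf_measure[of "\<lambda>y. card {w \<in> P. w < y}"]], clarify)
  fix a b assume "a \<in> P" "b \<in> P" "a < b"
  then have "{w \<in> P. w < a} \<subset> {w \<in> P. w < b}" by (auto intro: order_less_trans)
  then show "(a, b) \<in> measure (\<lambda>y. card {w \<in> P. w < y})"
    using finite by (simp add: psubset_card_mono)
qed

text \<open>Every element other than \<open>z\<close> has a lower cover, so each element is reached
  from \<open>z\<close> by finitely many covers.\<close>

lemma cover_induct [consumes 1, case_names bot cover]:
  assumes "y \<in> P" "Q z" "\<And>x y. covered_by P x y \<Longrightarrow> Q x \<Longrightarrow> Q y"
  shows "Q y"
proof -
  show ?thesis using wf_less assms(1)
  proof (induction y rule: wf_induct_rule)
    case (less y)
    show ?case
    proof (cases "y = z")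
      case False
      then have "z < y" using z_le less.prems by (simp add: order_less_le)
      then obtain w where w: "covered_by P w y" using ex_lower_cover z_in less.prems by blast
      then have "Q w" using less.IH unfolding covered_by_def by blast
      then show ?thesis using assms(3) w by blast
    qed (use assms in simp)
  qed
qed

lemma elem_rank_eq: "elem_rank P = r"
  unfolding elem_rank_def bot_eq
proof (rule the_equality)
  show "r z = 0 \<and> (\<forall>x y. covered_by P x y \<longrightarrow> r y = r x + 1) \<and> (\<forall>x. x \<notin> P \<longrightarrow> r x = 0)"
    using rank_z rank_cover rank_outside by blast
next
  fix s :: "'a \<Rightarrow> nat"
  assume s: "s z = 0 \<and> (\<forall>x y. covered_by P x y \<longrightarrow> s y = s x + 1) \<and> (\<forall>x. x \<notin> P \<longrightarrow> s x = 0)"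
  show "s = r"
  proof
    fix y
    show "s y = r y"
    proof (cases "y \<in> P")
      case True
      then show ?thesis
      proof (induction rule: cover_induct)
        case (cover x y)
        then show ?case using s rank_cover[of x y] by metis
      qed (use s rank_z in simp)
    qed (use s rank_outside in simp)
  qed
qed

lemma poset_rank_eq: "poset_rank P = r t"
  by (simp add: poset_rank_def elem_rank_eq top_eq)

lemma cover_mono:
  fixes g :: "'a \<Rightarrow> nat"
  assumes g: "\<And>x y. covered_by P x y \<Longrightarrow> g x \<le> g y" and "x \<in> P" "y \<in> P" "x \<le> y"
  shows "g x \<le> g y"
proof -
  show ?thesis using wf_less assms(3,4)
  proof (induction y rule: wf_induct_rule)
    case (less y)
    show ?case
    proof (cases "x = y")
      case False
      then have "x < y" using \<open>x \<le> y\<close> by simp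
      then obtain w where w: "covered_by P w y" "x \<le> w"
        using ex_lower_cover \<open>x \<in> P\<close> less.prems by blast
      then have "g x \<le> g w" using less unfolding covered_by_def by blast
      then show ?thesis using g[OF w(1)] by simp
    qed simp
  qed
qed

lemma le_rank:
  assumes "\<And>x y. covered_by P x y \<Longrightarrow> g y \<le> g x + 1" and "g z = 0" and "x \<in> P"
  shows "g x \<le> r x"
  using assms(3)
proof (induction rule: cover_induct)
  case (cover x y)
  then show ?case using assms(1)[of x y] rank_cover[of x y] by linarith
qed (simp add: assms(2))

lemma rank_mono: "x \<in> P \<Longrightarrow> y \<in> P \<Longrightarrow> x \<le> y \<Longrightarrow> r x \<le> r y"
  by (rule cover_mono) (auto dest: rank_cover)

lemma rank_pos: "x \<in> P \<Longrightarrow> x \<noteq> z \<Longrightarrow> 0 < r x"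
proof -
  assume x: "x \<in> P" "x \<noteq> z"
  then have "z < x" using z_le by (simp add: order_less_le)
  then obtain w where "covered_by P w x" using ex_lower_cover z_in x by blast
  from rank_cover[OF this] show ?thesis by simp
qed

lemma ex_rank_1:
  assumes "r t \<ge> 1"
  obtains a where "a \<in> P" "r a = 1"
proof -
  have "r y \<ge> 1 \<longrightarrow> (\<exists>a\<in>P. r a = 1)" if "y \<in> P" for y
    using that
  proof (induction rule: cover_induct)
    case (cover x y)
    then show ?case using rank_cover[OF cover(1)] unfolding covered_by_def by fastforce
  qed (simp add: rank_z)
  then show thesis using that assms t_in by blast
qed

end

section \<open>Maximal chains and the rank function of a finite ranked poset\<close>

lemma chain_iff:
  "pred_on.chain S (<) C \<longleftrightarrow> C \<subseteq> S \<and> (\<forall>x\<in>C. \<forall>y\<in>C. x \<le> y \<or> y \<le> (x::'a::order))"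
  unfolding pred_on.chain_def by (auto simp: order_le_less)

lemma maxchain_iff:
  fixes S :: "'a::order set"
  shows "pred_on.maxchain S (<) C \<longleftrightarrow> pred_on.chain S (<) C \<and>
    (\<forall>v\<in>S. (\<forall>w\<in>C. v \<le> w \<or> w \<le> v) \<longrightarrow> v \<in> C)" (is "_ \<longleftrightarrow> _ \<and> ?R")
proof -
  have "?R" if mx: "pred_on.maxchain S (<) C"
  proof (intro ballI impI, rule ccontr)
    fix v assume v: "v \<in> S" "\<forall>w\<in>C. v \<le> w \<or> w \<le> v" "v \<notin> C"
    have "pred_on.chain S (<) C" using mx unfolding pred_on.maxchain_def by blast
    then have "pred_on.chain S (<) (insert v C)" using v unfolding chain_iff by auto
    then show False using mx v unfolding pred_on.maxchain_def by blast
  qed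
  moreover have "pred_on.maxchain S (<) C" if "pred_on.chain S (<) C" "?R"
    unfolding pred_on.maxchain_def
  proof (intro conjI notI that)
    assume "\<exists>D. pred_on.chain S (<) D \<and> C \<subset> D"
    then obtain D v where "pred_on.chain S (<) D" "C \<subset> D" "v \<in> D" "v \<notin> C" by blast
    then show False using that(2) unfolding chain_iff by blast
  qed
  ultimately show ?thesis unfolding pred_on.maxchain_def by blast
qed

text \<open>An element comparable with the whole union is comparable with \<open>x\<close>, hence
  equals \<open>x\<close> or lies on one side of it, where \<open>C\<close> or \<open>E\<close> is
  already maximal.\<close>

lemma maxchain_glue:
  fixes P :: "'a::order set"
  assumes "x \<in> P" "pred_on.maxchain {w \<in> P. w < x} (<) C" "pred_on.maxchain {w \<in> P. x < w} (<) E"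
  shows "pred_on.maxchain P (<) (C \<union> insert x E)"
proof -
  have C: "\<And>w. w \<in> C \<Longrightarrow> w \<in> P \<and> w < x" and E: "\<And>w. w \<in> E \<Longrightarrow> w \<in> P \<and> x < w"
    using assms unfolding maxchain_iff chain_iff by auto
  have CC: "\<forall>x\<in>C. \<forall>y\<in>C. x \<le> y \<or> y \<le> x" "\<forall>x\<in>E. \<forall>y\<in>E. x \<le> y \<or> y \<le> x"
    using assms unfolding maxchain_iff chain_iff by auto
  have "pred_on.chain P (<) (C \<union> insert x E)"
    unfolding chain_iff
  proof (intro conjI ballI)
    fix a b assume "a \<in> C \<union> insert x E" "b \<in> C \<union> insert x E"
    then consider "a \<in> C" "b \<in> C" | "a \<in> E" "b \<in> E" | "a \<le> x" "x \<le> b" | "b \<le> x" "x \<le> a"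
      using C E by (auto simp: order_le_less)
    then show "a \<le> b \<or> b \<le> a"
      using CC by cases (blast intro: order_trans)+
  qed (use C E assms in auto)
  moreover have "v \<in> C \<union> insert x E" if "v \<in> P" "\<forall>w\<in>C \<union> insert x E. v \<le> w \<or> w \<le> v" for v
  proof -
    have "v \<le> x \<or> x \<le> v" using that by blast
    then consider "v = x" | "v < x" | "x < v" by (auto simp: order_le_less)
    then show ?thesis by cases (use that assms in \<open>auto simp: maxchain_iff\<close>)
  qed
  ultimately show ?thesis unfolding maxchain_iff by blast
qed

lemma maxchain_cover:
  fixes P :: "'a::order set"
  assumes "covered_by P x y" "pred_on.maxchain {w \<in> P. w < x} (<) C"
  shows "pred_on.maxchain {w \<in> P. w < y} (<) (insert x C)"
proof -
  have C: "\<And>w. w \<in> C \<Longrightarrow> w \<in> P \<and> w < x" 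
    using assms unfolding maxchain_iff chain_iff by auto
  have xy: "x \<in> P" "x < y" "\<And>v. v \<in> P \<Longrightarrow> x < v \<Longrightarrow> \<not> v < y"
    using assms(1) by (auto simp: covered_by_def)
  have CC: "\<forall>a\<in>C. \<forall>b\<in>C. a \<le> b \<or> b \<le> a"
    and max: "\<And>v. v \<in> P \<Longrightarrow> v < x \<Longrightarrow> \<forall>w\<in>C. v \<le> w \<or> w \<le> v \<Longrightarrow> v \<in> C"
    using assms(2) unfolding maxchain_iff chain_iff by blast+
  have "w < y" if "w \<in> C" for w using C[OF that] xy(2) by (blast intro: order.strict_trans)
  then have "pred_on.chain {w \<in> P. w < y} (<) (insert x C)"
    unfolding chain_iff using C CC xy(1,2) by (blast intro: order.strict_implies_order)
  moreover have "v \<in> insert x C" if "v \<in> P" "v < y" "\<forall>w\<in>insert x C. v \<le> w \<or> w \<le> v" for v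
  proof -
    have "v \<le> x \<or> x \<le> v" using that by blast
    then consider "v = x" | "v < x" | "x < v" by (auto simp: order_le_less)
    then show ?thesis by cases (use that max xy(3) in blast)+
  qed
  ultimately show ?thesis unfolding maxchain_iff by blast
qed

text \<open>The rank of \<open>x\<close> is the size of a maximal chain strictly below
  \<open>x\<close>. That all maximal chains of \<open>P\<close> have equal size makes it grow by one
  along covers.\<close>

lemma finite_ranked_poset_graded:
  fixes P :: "'a::order set"
  assumes "finite_ranked_poset P"
  obtains r z t where "graded P r z t"
proof -
  obtain z t where zt: "z \<in> P" "\<And>x. x \<in> P \<Longrightarrow> z \<le> x" "t \<in> P" "\<And>x. x \<in> P \<Longrightarrow> x \<le> t"
    using assms unfolding finite_ranked_poset_def by blast
  have fin: "finite P" using assms unfolding finite_ranked_poset_def by blast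
  have maxchains: "card C = card D"
    if "pred_on.maxchain P (<) C" "pred_on.maxchain P (<) D" for C D
    using assms that unfolding finite_ranked_poset_def by blast
  define M where "M x = (SOME C. pred_on.maxchain {w \<in> P. w < x} (<) C)" for x
  have M: "pred_on.maxchain {w \<in> P. w < x} (<) (M x)" for x
    unfolding M_def by (rule someI_ex) (rule pred_on.Hausdorff)
  have Msub: "M x \<subseteq> {w \<in> P. w < x}" for x
    using M unfolding maxchain_iff chain_iff by blast
  define r where "r x = (if x \<in> P then card (M x) else 0)" for x
  have r_cover: "r y = r x + 1" if cov: "covered_by P x y" for x y
  proof -
    have P: "x \<in> P" "y \<in> P" using cov by (auto simp: covered_by_def)
    obtain E where E: "pred_on.maxchain {w \<in> P. y < w} (<) E"
      using pred_on.Hausdorff by blast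
    have Esub: "E \<subseteq> {w \<in> P. y < w}" using E unfolding maxchain_iff chain_iff by blast
    have "finite E" using finite_subset[OF Esub] fin by simp
    then have finE: "finite (insert y E)" by simp
    have split: "card (C \<union> insert y E) = card C + card (insert y E)"
      if C: "C \<subseteq> {w \<in> P. w < y}" for C
    proof (rule card_Un_disjoint[OF _ finE])
      show "finite C" using finite_subset[OF C] fin by simp
      show "C \<inter> insert y E = {}" using C Esub by (auto dest: order_less_asym)
    qed
    have D: "pred_on.maxchain {w \<in> P. w < y} (<) (insert x (M x))"
      by (rule maxchain_cover[OF cov M])
    then have Dsub: "insert x (M x) \<subseteq> {w \<in> P. w < y}" unfolding maxchain_iff chain_iff by blast
    \<comment> \<open>Two maximal chains below \<open>y\<close>, one of them through
      \<open>x\<close>, are completed by the same upper part to maximal chains of \<open>P\<close>;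
      cancelling that part shows that they have equal size.\<close>
    have "card (insert x (M x) \<union> insert y E) = card (M y \<union> insert y E)"
      by (rule maxchains) (rule maxchain_glue[OF P(2) D E], rule maxchain_glue[OF P(2) M E])
    then have "card (insert x (M x)) = card (M y)"
      using split[OF Dsub] split[OF Msub] by simp
    moreover have "finite (M x)" using finite_subset[OF Msub] fin by simp
    moreover have "x \<notin> M x" using Msub[of x] by blast
    ultimately show ?thesis using P by (simp add: r_def)
  qed
  show thesis
  proof (rule that[of r z t], unfold_locales)
    have "{w \<in> P. w < z} = {}" using zt(2) by (auto dest: leD)
    then have "M z = {}" using Msub[of z] by blast
    then show "r z = 0" by (simp add: r_def)
    show "r y = r x + 1" if "covered_by P x y" for x y using that by (rule r_cover)
  qed (use fin zt in \<open>auto simp: r_def\<close>)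
qed

section \<open>Covers in the Boolean lattice and in products\<close>

lemma covered_by_Pow_card:
  assumes "covered_by (Pow S) A B" "finite S"
  shows "card B = card A + 1"
proof -
  have AB: "A \<subseteq> S" "B \<subseteq> S" "A \<subset> B" using assms by (auto simp: covered_by_def)
  then obtain b where b: "b \<in> B" "b \<notin> A" by blast
  have "\<not> insert b A \<subset> B"
  proof
    assume "insert b A \<subset> B"
    moreover have "A \<subset> insert b A" "insert b A \<in> Pow S" using b AB by auto
    ultimately show False using assms(1) unfolding covered_by_def by blast
  qed
  then have "B = insert b A" using AB b by blast
  moreover have "finite A" using AB(1) assms(2) by (rule finite_subset)
  ultimately show ?thesis using b by simp
qed

lemma graded_boolean_lattice:
  "graded (boolean_lattice n) (\<lambda>A. if A \<subseteq> {1..n} then card A else 0) {} {1..n}"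
proof
  fix A B assume "covered_by (boolean_lattice n) A B"
  then show "(if B \<subseteq> {1..n} then card B else 0) = (if A \<subseteq> {1..n} then card A else 0) + 1"
    using covered_by_Pow_card[of "{1..n}" A B]
    by (auto simp: boolean_lattice_def covered_by_def)
qed (auto simp: boolean_lattice_def)

lemma Pair_less_iff:
  "(a, b) < (c, d) \<longleftrightarrow> a < c \<and> b \<le> d \<or> a \<le> c \<and> b < (d::'b::order)" for a c :: "'a::order"
  by (auto simp: less_le_not_le)

lemma covered_by_Times:
  assumes "covered_by (P \<times> Q) p q"
  obtains (left) x x' y where "p = (x, y)" "q = (x', y)" "covered_by P x x'" "y \<in> Q"
    | (right) x y y' where "p = (x, y)" "q = (x, y')" "covered_by Q y y'" "x \<in> P"
proof -
  obtain x y x' y' where pq: "p = (x, y)" "q = (x', y')" by (cases p, cases q) auto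
  have in_PQ: "x \<in> P" "x' \<in> P" "y \<in> Q" "y' \<in> Q"
    and lt: "x < x' \<and> y \<le> y' \<or> x \<le> x' \<and> y < y'"
    using assms unfolding pq covered_by_def by (simp_all add: Pair_less_iff)
  have no: "\<not> (v < x' \<and> w \<le> y' \<or> v \<le> x' \<and> w < y')"
    if "v \<in> P" "w \<in> Q" "x < v \<and> y \<le> w \<or> x \<le> v \<and> y < w" for v w
    using assms that unfolding pq covered_by_def Bex_def mem_Times_iff split_paired_Ex
    by (auto simp only: Pair_less_iff fst_conv snd_conv)
  \<comment> \<open>If both coordinates grew, \<open>(x', y)\<close> would lie strictly between
    \<open>p\<close> and \<open>q\<close>.\<close>
  consider "x < x'" "y = y'" | "x = x'" "y < y'"
    using lt no[of x' y] in_PQ by (metis order.order_iff_strict order_refl)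
  then show thesis
  proof cases
    case 1
    then show thesis
      using left[of x y x'] pq in_PQ no[of _ y] unfolding covered_by_def by blast
  next
    case 2
    then show thesis
      using right[of x y y'] pq in_PQ no[of x] unfolding covered_by_def by blast
  qed
qed

lemma covered_by_Times_left:
  "covered_by P x x' \<Longrightarrow> y \<in> Q \<Longrightarrow> covered_by (P \<times> Q) (x, y) (x', y)"
  by (auto simp: covered_by_def Pair_less_iff)

lemma covered_by_Times_right:
  "covered_by Q y y' \<Longrightarrow> x \<in> P \<Longrightarrow> covered_by (P \<times> Q) (x, y) (x, y')"
  by (auto simp: covered_by_def Pair_less_iff)

section \<open>Independent sets in graphs without large sparse sets\<close>

definition indep_sets :: "('a \<Rightarrow> 'a \<Rightarrow> bool) \<Rightarrow> 'a set \<Rightarrow> 'a set set" where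
  "indep_sets E A = {I. I \<subseteq> A \<and> (\<forall>x\<in>I. \<forall>y\<in>I. \<not> E x y)}"

lemma finite_indep_sets: "finite A \<Longrightarrow> finite (indep_sets E A)"
  unfolding indep_sets_def by (rule finite_subset[of _ "Pow A"]) auto

lemma card_indep_sets_le_power: "finite A \<Longrightarrow> card (indep_sets E A) \<le> 2 ^ card A"
  unfolding card_Pow[symmetric] by (rule card_mono) (auto simp: indep_sets_def)

text \<open>Independent sets without \<open>v\<close> lie in \<open>A - {v}\<close>; those with
  \<open>v\<close> avoid its neighbours and are determined by their other members.\<close>

lemma card_indep_sets_branch:
  assumes "finite A"
  shows "card (indep_sets E A)
    \<le> card (indep_sets E (A - {v})) + card (indep_sets E {w \<in> A - {v}. \<not> E v w})"
proof -
  let ?B = "{w \<in> A - {v}. \<not> E v w}"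
  have "indep_sets E A \<subseteq> indep_sets E (A - {v}) \<union> insert v ` indep_sets E ?B"
  proof
    fix I assume I: "I \<in> indep_sets E A"
    show "I \<in> indep_sets E (A - {v}) \<union> insert v ` indep_sets E ?B"
    proof (cases "v \<in> I")
      case True
      then have "I = insert v (I - {v})" "I - {v} \<in> indep_sets E ?B"
        using I by (auto simp: indep_sets_def)
      then show ?thesis by blast
    qed (use I in \<open>auto simp: indep_sets_def\<close>)
  qed
  moreover have fin: "finite (indep_sets E (A - {v}))" "finite (indep_sets E ?B)"
    using assms by (simp_all add: finite_indep_sets)
  ultimately have "card (indep_sets E A) \<le> card (indep_sets E (A - {v}) \<union> insert v ` indep_sets E ?B)"
    by (intro card_mono) auto
  also have "\<dots> \<le> card (indep_sets E (A - {v})) + card (insert v ` indep_sets E ?B)"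
    by (rule card_Un_le)
  also have "\<dots> \<le> card (indep_sets E (A - {v})) + card (indep_sets E ?B)"
    using card_image_le[OF fin(2)] by simp
  finally show ?thesis .
qed

text \<open>
  Branching on a vertex of degree at least \<open>D\<close> gives the recursion
  \<open>i(A) \<le> i(A - v) + i(A - v - N(v))\<close>, whose growth rate per vertex is \<open>exp u\<close> as soon as
  \<open>exp (- u) + exp (- u * (1 + D)) \<le> 1\<close>.
\<close>

lemma card_indep_sets_le_exp:
  fixes D M K u :: real
  assumes "finite V" and irrefl: "\<And>v. \<not> E v v"
    and u: "0 \<le> u" "1 + exp (- u * D) \<le> exp u"
    and dense: "\<And>A. A \<subseteq> V \<Longrightarrow> M < card A \<Longrightarrow> \<exists>v\<in>A. D \<le> card {w \<in> A. E v w}"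
    and sparse: "\<And>A. A \<subseteq> V \<Longrightarrow> card A \<le> M \<Longrightarrow> card (indep_sets E A) \<le> K"
    and "0 \<le> K" "A \<subseteq> V"
  shows "card (indep_sets E A) \<le> K * exp (u * card A)"
proof -
  have "finite A" using assms finite_subset by blast
  then show ?thesis using \<open>A \<subseteq> V\<close>
  proof (induction A rule: finite_psubset_induct)
    case (psubset A)
    show ?case
    proof (cases "card A \<le> M")
      case True
      have "K * 1 \<le> K * exp (u * card A)"
        using u(1) \<open>0 \<le> K\<close> by (intro mult_left_mono) auto
      then show ?thesis using sparse[OF psubset.prems True] by simp
    next
      case False
      then obtain v where v: "v \<in> A" "D \<le> card {w \<in> A. E v w}"
        using dense[OF psubset.prems] by (auto simp: not_le)
      let ?B = "{w \<in> A - {v}. \<not> E v w}"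
      have "insert v {w \<in> A. E v w} \<union> ?B = A" "insert v {w \<in> A. E v w} \<inter> ?B = {}"
        using v by auto
      then have "card A = card (insert v {w \<in> A. E v w}) + card ?B"
        using psubset.hyps by (metis (no_types, lifting) card_Un_disjoint finite_Un)
      also have "card (insert v {w \<in> A. E v w}) = Suc (card {w \<in> A. E v w})"
        using irrefl psubset.hyps by simp
      finally have B: "real (card ?B) \<le> real (card A) - 1 - D" using v(2) by simp
      have A: "real (card (A - {v})) = real (card A) - 1"
        using card.remove[OF psubset.hyps v(1)] by simp
      have "real (card (indep_sets E A))
          \<le> real (card (indep_sets E (A - {v}))) + real (card (indep_sets E ?B))"
        using card_indep_sets_branch[OF psubset.hyps] by (metis of_nat_add of_nat_le_iff)
      also have "\<dots> \<le> K * exp (u * card (A - {v})) + K * exp (u * card ?B)"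
        using v(1) psubset.prems by (intro add_mono psubset.IH) auto
      also have "\<dots> \<le> K * exp (u * (real (card A) - 1)) + K * exp (u * (real (card A) - 1 - D))"
        using B u(1) \<open>0 \<le> K\<close> unfolding A
        by (intro add_mono mult_left_mono iffD2[OF exp_le_cancel_iff]) simp_all
      also have "\<dots> = K * exp (u * (real (card A) - 1)) * (1 + exp (- u * D))"
        by (simp add: distrib_left right_diff_distrib exp_diff exp_minus divide_inverse)
      also have "\<dots> \<le> K * exp (u * (real (card A) - 1)) * exp u"
        using u(2) \<open>0 \<le> K\<close> by (intro mult_left_mono) auto
      also have "\<dots> = K * exp (u * card A)" by (simp add: right_diff_distrib exp_diff)
      finally show ?thesis .
    qed
  qed
qed

section \<open>Families with few comparable pairs\<close>

lemma le_binomial: "0 < k \<Longrightarrow> k < m \<Longrightarrow> m \<le> m choose k"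
proof (induction m arbitrary: k)
  case (Suc m)
  then obtain j where j: "k = Suc j" by (cases k) auto
  show ?case
  proof (cases "k = m")
    case False
    then have "m \<le> m choose k" "1 \<le> m choose j" using Suc j by (auto simp: Suc_le_eq)
    then show ?thesis unfolding j binomial_Suc_Suc by linarith
  qed (use binomial_symmetric[of m "Suc m"] in simp)
qed simp

lemma fact_mult_fact_le:
  assumes "0 < k" "k < m"
  shows "m * (fact k * fact (m - k)) \<le> (fact m :: nat)"
proof -
  have "m * (fact k * fact (m - k)) \<le> (m choose k) * (fact k * fact (m - k))"
    by (rule mult_le_mono1[OF le_binomial[OF assms]])
  also have "\<dots> = fact m" using binomial_fact_lemma[of k m] assms by (simp add: mult_ac)
  finally show ?thesis .
qed

text \<open>The products count maximal chains of a Boolean lattice through two nested sets of sizes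
  \<open>a\<close> and \<open>b\<close>, or through one of them. If \<open>a \<le> n / 2\<close>,
  chains through the smaller set are spread evenly over at least \<open>n - a \<ge> n / 2\<close>
  candidates for the larger one. Otherwise \<open>b > n / 2\<close>, and the same holds downwards
  from the larger set.\<close>

lemma chain_pair_weight_le:
  assumes "0 < a" "a < b" "b < n"
  shows "n * (fact a * fact (b - a) * fact (n - b))
    \<le> 2 * (fact a * fact (n - a) + fact b * fact (n - b) :: nat)"
proof (cases "2 * a \<le> n")
  case True
  have "n * (fact a * fact (b - a) * fact (n - b))
      \<le> (2 * (n - a)) * (fact a * fact (b - a) * fact (n - b))"
    using True by (intro mult_le_mono1) simp
  also have "\<dots> = 2 * fact a * ((n - a) * (fact (b - a) * fact ((n - a) - (b - a))))"
    using assms by (simp add: mult_ac)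
  also have "\<dots> \<le> 2 * fact a * fact (n - a)"
    using assms by (intro mult_le_mono2 fact_mult_fact_le) auto
  also have "\<dots> \<le> 2 * (fact a * fact (n - a) + fact b * fact (n - b))" by simp
  finally show ?thesis .
next
  case False
  have "n * (fact a * fact (b - a) * fact (n - b))
      \<le> (2 * b) * (fact a * fact (b - a) * fact (n - b))"
    using False assms by (intro mult_le_mono1) simp
  also have "\<dots> = 2 * fact (n - b) * (b * (fact a * fact (b - a)))"
    by (simp add: mult_ac)
  also have "\<dots> \<le> 2 * fact (n - b) * fact b"
    using assms by (intro mult_le_mono2 fact_mult_fact_le) auto
  also have "\<dots> \<le> 2 * (fact a * fact (n - a) + fact b * fact (n - b))" by simp
  finally show ?thesis .
qed

text \<open>A permutation encodes the maximal chain of its prefix sets. This chain passes through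
  \<open>A\<close> if an ordering of \<open>A\<close> is followed by one of \<open>S - A\<close>;
  such concatenations are distinct because the first part has fixed length.\<close>

lemma card_prefix_ge:
  assumes "finite S" "A \<subseteq> S"
  shows "fact (card A) * fact (card S - card A)
    \<le> card {xs \<in> permutations_of_set S. set (take (card A) xs) = A}"
proof -
  let ?X = "permutations_of_set A \<times> permutations_of_set (S - A)"
  have fin: "finite A" using assms finite_subset by blast
  have len: "length ys = card A" if "ys \<in> permutations_of_set A" for ys
    using that by (rule length_finite_permutations_of_set)
  have inj: "inj_on (\<lambda>(ys, zs). ys @ zs) ?X"
  proof (rule inj_onI, clarify)
    fix ys zs ys' zs' :: "'a list"
    assume "ys \<in> permutations_of_set A" "ys' \<in> permutations_of_set A" "ys @ zs = ys' @ zs'"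
    then show "ys = ys' \<and> zs = zs'" using len by (metis append_eq_append_conv)
  qed
  have "(\<lambda>(ys, zs). ys @ zs) ` ?X \<subseteq> {xs \<in> permutations_of_set S. set (take (card A) xs) = A}"
    using len assms(2) by (auto simp: permutations_of_set_def)
  then have "card ((\<lambda>(ys, zs). ys @ zs) ` ?X)
      \<le> card {xs \<in> permutations_of_set S. set (take (card A) xs) = A}"
    by (intro card_mono) auto
  also have "card ((\<lambda>(ys, zs). ys @ zs) ` ?X) = card ?X" by (rule card_image[OF inj])
  also have "\<dots> = fact (card A) * fact (card S - card A)"
    using fin assms by (simp add: card_cartesian_product card_Diff_subset)
  finally show ?thesis .
qed

lemma card_prefix2_le:
  assumes "finite S" "A \<subseteq> B" "B \<subseteq> S"
  shows "card {xs \<in> permutations_of_set S. set (take (card A) xs) = A \<and> set (take (card B) xs) = B}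
    \<le> fact (card A) * fact (card B - card A) * fact (card S - card B)" (is "card ?L \<le> _")
proof -
  let ?X = "permutations_of_set A \<times> permutations_of_set (B - A) \<times> permutations_of_set (S - B)"
  have fin: "finite B" "finite A"
    using finite_subset[OF assms(3,1)] finite_subset[OF assms(2)] by simp_all
  have sub: "?L \<subseteq> (\<lambda>(xs, ys, zs). xs @ ys @ zs) ` ?X"
  proof
    fix xs assume xs: "xs \<in> ?L"
    define a b where "a = card A" and "b = card B"
    have "a \<le> b" using card_mono[OF fin(1) assms(2)] by (simp add: a_def b_def)
    have d: "distinct xs" "set xs = S" "set (take a xs) = A" "set (take b xs) = B"
      using xs by (simp_all add: permutations_of_set_def a_def b_def)
    have eq: "take a xs @ drop a (take b xs) = take b xs"
      using append_take_drop_id[of a "take b xs"] \<open>a \<le> b\<close> by (simp add: min_def)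
    have Diff: "set zs = set (ys @ zs) - set ys" if "distinct (ys @ zs)" for ys zs :: "'a list"
      using that by auto
    have "set (drop a (take b xs)) = B - A"
      using Diff[of "take a xs" "drop a (take b xs)", unfolded eq, OF distinct_take[OF d(1)]]
      unfolding d(3,4) .
    moreover have "set (drop b xs) = S - B"
      using Diff[of "take b xs" "drop b xs", unfolded append_take_drop_id, OF d(1)]
      unfolding d(2,4) .
    ultimately have in_X: "(take a xs, drop a (take b xs), drop b xs) \<in> ?X"
      using d by (simp add: permutations_of_set_def)
    have split: "xs = take a xs @ drop a (take b xs) @ drop b xs"
      unfolding append.assoc[symmetric] eq append_take_drop_id ..
    show "xs \<in> (\<lambda>(xs, ys, zs). xs @ ys @ zs) ` ?X"
      by (rule image_eqI[OF _ in_X]) (simp only: prod.case split[symmetric])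
  qed
  have "card ?L \<le> card ((\<lambda>(xs, ys, zs). xs @ ys @ zs) ` ?X)"
    by (rule card_mono[OF _ sub]) simp
  also have "\<dots> \<le> card ?X" by (rule card_image_le) auto
  also have "\<dots> = fact (card A) * fact (card B - card A) * fact (card S - card B)"
    using fin assms by (simp add: card_cartesian_product card_Diff_subset finite_Diff)
  finally show ?thesis .
qed

text \<open>A minimal member lies below all others, which already gives \<open>card T - 1\<close>
  pairs.\<close>

lemma card_chain_le_pairs:
  fixes T :: "'a set set"
  assumes "finite T" "\<And>A B. A \<in> T \<Longrightarrow> B \<in> T \<Longrightarrow> A \<subseteq> B \<or> B \<subseteq> A"
  shows "card T \<le> 1 + (\<Sum>A\<in>T. card {B \<in> T. A \<subset> B})"
proof (cases "T = {}")
  case False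
  then obtain A where A: "A \<in> T" "\<And>B. B \<in> T \<Longrightarrow> B \<subseteq> A \<Longrightarrow> B = A"
    using finite_has_minimal[OF \<open>finite T\<close>] by metis
  have "T - {A} \<subseteq> {B \<in> T. A \<subset> B}" using A assms(2) by blast
  then have "card (T - {A}) \<le> card {B \<in> T. A \<subset> B}"
    by (rule card_mono[rotated]) (simp add: assms(1))
  also have "\<dots> \<le> (\<Sum>A\<in>T. card {B \<in> T. A \<subset> B})"
    by (rule member_le_sum[OF A(1)]) (simp_all add: assms(1))
  finally show ?thesis using card.remove[OF assms(1) A(1)] by simp
qed simp

lemma card_filter_eq_sum: "finite A \<Longrightarrow> card {x \<in> A. Q x} = (\<Sum>x\<in>A. of_bool (Q x))"
  by (simp add: Int_def)

text \<open>
  Count over all maximal chains of \<open>Pow S\<close>, given by the permutations of \<open>S\<close>: a chain that meets \<open>F\<close>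
  in \<open>j\<close> sets contains at least \<open>j - 1\<close> pairs of \<open>F\<close>.
\<close>

lemma lym_pairs:
  assumes S: "finite S" and F: "F \<subseteq> Pow S"
  shows "(\<Sum>A\<in>F. fact (card A) * fact (card S - card A)) \<le> fact (card S) +
    (\<Sum>A\<in>F. \<Sum>B\<in>F. of_bool (A \<subset> B) *
      (fact (card A) * fact (card B - card A) * fact (card S - card B)) :: nat)"
proof -
  let ?\<Pi> = "permutations_of_set S"
  define on where "on xs A \<longleftrightarrow> set (take (card A) xs) = A" for xs and A :: "'a set"
  have fin: "finite F" using S F by (meson finite_Pow_iff finite_subset)
  have on_mono: "A \<subseteq> B" if "on xs A" "on xs B" "card A \<le> card B" for xs A B
    using that unfolding on_def by (metis set_take_subset_set_take)
  have "(\<Sum>A\<in>F. fact (card A) * fact (card S - card A)) \<le> (\<Sum>A\<in>F. card {xs \<in> ?\<Pi>. on xs A})"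
    unfolding on_def using F S by (intro sum_mono card_prefix_ge) auto
  also have "\<dots> = (\<Sum>A\<in>F. \<Sum>xs\<in>?\<Pi>. of_bool (on xs A))"
    by (intro sum.cong refl card_filter_eq_sum) simp
  also have "\<dots> = (\<Sum>xs\<in>?\<Pi>. \<Sum>A\<in>F. of_bool (on xs A))"
    by (rule sum.swap)
  also have "\<dots> = (\<Sum>xs\<in>?\<Pi>. card {A \<in> F. on xs A})"
    by (simp only: card_filter_eq_sum[OF fin])
  also have "\<dots> \<le> (\<Sum>xs\<in>?\<Pi>. 1 + (\<Sum>A\<in>{A \<in> F. on xs A}. card {B \<in> {A \<in> F. on xs A}. A \<subset> B}))"
    using fin on_mono by (intro sum_mono card_chain_le_pairs) (auto, metis nat_le_linear subsetD)
  also have "\<dots> = fact (card S) + (\<Sum>xs\<in>?\<Pi>. \<Sum>A\<in>F. \<Sum>B\<in>F. of_bool (on xs A \<and> on xs B \<and> A \<subset> B))"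
  proof -
    have "(\<Sum>A\<in>{A \<in> F. on xs A}. card {B \<in> {A \<in> F. on xs A}. A \<subset> B})
        = (\<Sum>A\<in>F. \<Sum>B\<in>F. of_bool (on xs A \<and> on xs B \<and> A \<subset> B))" for xs
      unfolding sum.inter_filter[OF fin]
    proof (rule sum.cong[OF refl])
      fix A assume "A \<in> F"
      have "{B \<in> {A \<in> F. on xs A}. A \<subset> B} = {B \<in> F. on xs B \<and> A \<subset> B}" by blast
      then have "card {B \<in> {A \<in> F. on xs A}. A \<subset> B} = (\<Sum>B\<in>F. of_bool (on xs B \<and> A \<subset> B))"
        by (simp only: card_filter_eq_sum[OF fin])
      then show "(if on xs A then card {B \<in> {A \<in> F. on xs A}. A \<subset> B} else 0)
          = (\<Sum>B\<in>F. of_bool (on xs A \<and> on xs B \<and> A \<subset> B))" by simp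
    qed
    then show ?thesis using S by (simp add: sum_Suc)
  qed
  also have "(\<Sum>xs\<in>?\<Pi>. \<Sum>A\<in>F. \<Sum>B\<in>F. of_bool (on xs A \<and> on xs B \<and> A \<subset> B))
      = (\<Sum>A\<in>F. \<Sum>B\<in>F. \<Sum>xs\<in>?\<Pi>. of_bool (on xs A \<and> on xs B \<and> A \<subset> B) :: nat)"
    by (subst sum.swap) (intro sum.cong refl sum.swap)
  also have "\<dots> = (\<Sum>A\<in>F. \<Sum>B\<in>F. card {xs \<in> ?\<Pi>. on xs A \<and> on xs B \<and> A \<subset> B})"
    by (simp only: card_filter_eq_sum[OF finite_permutations_of_set])
  also have "\<dots> \<le> (\<Sum>A\<in>F. \<Sum>B\<in>F. of_bool (A \<subset> B) *
      (fact (card A) * fact (card B - card A) * fact (card S - card B)))"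
  proof (intro sum_mono)
    fix A B assume AB: "A \<in> F" "B \<in> F"
    show "card {xs \<in> ?\<Pi>. on xs A \<and> on xs B \<and> A \<subset> B} \<le> of_bool (A \<subset> B) *
      (fact (card A) * fact (card B - card A) * fact (card S - card B))"
    proof (cases "A \<subset> B")
      case True
      then show ?thesis using card_prefix2_le[OF S, of A B] F AB by (auto simp: on_def)
    qed simp
  qed
  finally show ?thesis by simp
qed

text \<open>The weight \<open>w A\<close> is the number of maximal chains through \<open>A\<close>.
  \<open>lym_pairs\<close> bounds the total weight \<open>W\<close> by \<open>fact n + X\<close>,
  and the degree bound gives \<open>X \<le> 2 * D * W / n\<close>. Every weight is at least
  \<open>fact n\<close> divided by the central binomial coefficient. Excluding \<open>{}\<close> and
  \<open>S\<close> keeps sizes strictly between 0 and \<open>n\<close>, as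
  \<open>chain_pair_weight_le\<close> demands.\<close>

lemma card_mult_le_central_binomial:
  fixes D :: real
  assumes S: "finite S" and F: "F \<subseteq> Pow S - {{}, S}" and D: "2 * D \<le> card S" "S \<noteq> {}"
    and deg: "\<And>A. A \<in> F \<Longrightarrow> card {B \<in> F. A \<subset> B \<or> B \<subset> A} \<le> D"
  shows "card F * (1 - 2 * D / card S) \<le> card S choose (card S div 2)"
proof -
  define n where "n = card S"
  define w where "w A = fact (card A) * (fact (n - card A) :: nat)" for A :: "'a set"
  have n: "0 < n" using S D(2) by (simp add: n_def card_gt_0_iff)
  have fin: "finite F" using S F by (meson finite_Diff finite_Pow_iff finite_subset)
  define C where "C = real (n choose (n div 2))"
  define W where "W = (\<Sum>A\<in>F. w A)"
  let ?p = "\<lambda>A B. fact (card A) * fact (card B - card A) * fact (n - card B) :: nat"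
  define X where "X = (\<Sum>A\<in>F. \<Sum>B\<in>F. of_bool (A \<subset> B) * ?p A B)"
  have "n * X
      = (\<Sum>A\<in>F. \<Sum>B\<in>F. of_bool (A \<subset> B) * (n * ?p A B))"
    by (simp add: X_def sum_distrib_left mult_ac)
  also have "\<dots> \<le> (\<Sum>A\<in>F. \<Sum>B\<in>F. of_bool (A \<subset> B) * (2 * (w A + w B)))"
  proof (intro sum_mono)
    fix A B assume AB: "A \<in> F" "B \<in> F"
    show "of_bool (A \<subset> B) * (n * ?p A B) \<le> of_bool (A \<subset> B) * (2 * (w A + w B))"
    proof (cases "A \<subset> B")
      case True
      have "B \<subset> S" "A \<noteq> {}" using AB F by auto
      then have "card A < card B" "card B < n" "0 < card A"
        using True S psubset_card_mono[of B A] psubset_card_mono[of S B] finite_subset[of _ S]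
        by (auto simp: n_def card_gt_0_iff)
      then show ?thesis using chain_pair_weight_le[of "card A" "card B" n] by (simp add: w_def)
    qed simp
  qed
  also have "\<dots> = 2 * (\<Sum>A\<in>F. \<Sum>B\<in>F. of_bool (A \<subset> B) * w A) + 2 * (\<Sum>A\<in>F. \<Sum>B\<in>F. of_bool (A \<subset> B) * w B)"
    by (simp add: sum_distrib_left algebra_simps sum.distrib)
  \<comment> \<open>Exchanging the names of the two sets charges each pair to both of its ends, so
    \<open>w A\<close> is counted once per set comparable with \<open>A\<close>.\<close>
  also have "(\<Sum>A\<in>F. \<Sum>B\<in>F. of_bool (A \<subset> B) * w B) = (\<Sum>A\<in>F. \<Sum>B\<in>F. of_bool (B \<subset> A) * w A)"
    by (rule sum.swap)
  also have "2 * (\<Sum>A\<in>F. \<Sum>B\<in>F. of_bool (A \<subset> B) * w A) + 2 * \<dots>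
      = 2 * (\<Sum>A\<in>F. w A * card {B \<in> F. A \<subset> B \<or> B \<subset> A})"
  proof -
    have "(\<Sum>B\<in>F. of_bool (A \<subset> B) * w A) + (\<Sum>B\<in>F. of_bool (B \<subset> A) * w A)
        = w A * card {B \<in> F. A \<subset> B \<or> B \<subset> A}" for A
    proof -
      have "of_bool (A \<subset> B) + of_bool (B \<subset> A) = (of_bool (A \<subset> B \<or> B \<subset> A) :: nat)" for B
        by auto
      then have "w A * (\<Sum>B\<in>F. of_bool (A \<subset> B \<or> B \<subset> A))
          = w A * (\<Sum>B\<in>F. of_bool (A \<subset> B) + of_bool (B \<subset> A))"
        by presburger
      then show ?thesis
        unfolding card_filter_eq_sum[OF fin] by (simp add: sum_distrib_left algebra_simps sum.distrib)
    qed
    then show ?thesis by (simp add: sum.distrib[symmetric] distrib_left[symmetric])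
  qed
  finally have "real (n * X)
      \<le> 2 * (\<Sum>A\<in>F. real (w A) * card {B \<in> F. A \<subset> B \<or> B \<subset> A})"
    by (simp only: of_nat_le_iff[symmetric, where 'a = real]) simp
  also have "\<dots> \<le> 2 * (\<Sum>A\<in>F. real (w A) * D)"
    by (intro mult_left_mono sum_mono deg) auto
  also have "\<dots> = 2 * D * W" by (simp add: W_def sum_distrib_left mult_ac)
  finally have pairs: "real X \<le> 2 * D * W / n"
    using n by (simp add: field_simps)
  have "F \<subseteq> Pow S" using F by blast
  from lym_pairs[OF S this] have "W \<le> fact n + X"
    by (simp only: W_def w_def n_def X_def)
  then have "real W \<le> real (fact n + X)" by (simp only: of_nat_le_iff)
  then have "real W \<le> fact n + real X" by simp
  then have W: "W * (1 - 2 * D / n) \<le> fact n" using pairs by (simp add: algebra_simps)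
  have "card F * fact n \<le> W * (n choose (n div 2))"
  proof -
    have "fact n \<le> w A * (n choose (n div 2))" if "A \<in> F" for A
    proof -
      have "card A \<le> n" using that F S card_mono[of S A] by (auto simp: n_def)
      then have "fact n = w A * (n choose card A)"
        using binomial_fact_lemma[of "card A" n] by (simp add: w_def mult_ac)
      then show ?thesis using binomial_maximum[of n "card A"] by simp
    qed
    then have "(\<Sum>A\<in>F. fact n) \<le> (\<Sum>A\<in>F. w A * (n choose (n div 2)))" by (rule sum_mono)
    then show ?thesis by (simp add: W_def sum_distrib_right)
  qed
  then have "real (card F * fact n) \<le> real (W * (n choose (n div 2)))" by (simp only: of_nat_le_iff)
  then have "real (card F) * fact n \<le> real W * C" by (simp add: C_def)
  then have "real (card F) * fact n * (1 - 2 * D / n) \<le> real W * C * (1 - 2 * D / n)"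
    using D n by (intro mult_right_mono) (auto simp: n_def field_simps)
  also have "\<dots> = real W * (1 - 2 * D / n) * C" by simp
  also have "\<dots> \<le> fact n * C" by (rule mult_right_mono[OF W]) (simp add: C_def)
  finally have "fact n * (card F * (1 - 2 * D / n)) \<le> fact n * C" by (simp add: mult_ac)
  then show ?thesis by (simp add: n_def C_def)
qed

section \<open>The number of upsets of the Boolean lattice\<close>

lemma central_binomial_square_ge_even: "0 < m \<Longrightarrow> 16 ^ m \<le> 4 * m * (2 * m choose m)\<^sup>2"
proof (induction m)
  case (Suc m)
  show ?case
  proof (cases "m = 0")
    case False
    define c c' where "c = (2 * m choose m)" and "c' = (2 * Suc m choose Suc m)"
    have "Suc (2 * m) choose m = (Suc (2 * m) choose Suc m)"
      by (subst binomial_symmetric) simp_all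
    moreover have "2 * Suc m = Suc (Suc (2 * m))" by simp
    ultimately have "c' = 2 * (Suc (2 * m) choose Suc m)"
      by (simp only: c'_def binomial_Suc_Suc mult_2)
    then have "Suc m * c' = 2 * (Suc m * (Suc (2 * m) choose Suc m))"
      by (simp only: mult.left_commute)
    then have c': "Suc m * c' = 2 * (Suc (2 * m) * c)"
      by (simp only: Suc_times_binomial c_def)
    have "Suc m * 16 ^ Suc m = 16 * (Suc m * 16 ^ m)" by simp
    also have "\<dots> \<le> 16 * (Suc m * (4 * m * c\<^sup>2))"
      using Suc.IH False by (intro mult_le_mono2) (simp add: c_def)
    also have "\<dots> \<le> 16 * ((Suc (2 * m))\<^sup>2 * c\<^sup>2)"
    proof (intro mult_le_mono2)
      \<comment> \<open>The induction rests on
        \<open>4 * m * (m + 1) \<le> (2 * m + 1)\<^sup>2\<close> together with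
        \<open>(m + 1) * c' = 2 * (2 * m + 1) * c\<close>.\<close>
      have "Suc m * (4 * m) * c\<^sup>2 \<le> (Suc (2 * m))\<^sup>2 * c\<^sup>2"
        by (rule mult_le_mono1) (simp add: power2_eq_square)
      then show "Suc m * (4 * m * c\<^sup>2) \<le> (Suc (2 * m))\<^sup>2 * c\<^sup>2" by (simp only: mult.assoc)
    qed
    also have "\<dots> = 4 * (Suc m * c')\<^sup>2"
      by (simp only: c' power_mult_distrib) simp
    also have "\<dots> = Suc m * (4 * Suc m * c'\<^sup>2)"
      by (simp only: power_mult_distrib) (simp only: power2_eq_square mult.assoc mult.left_commute)
    finally show ?thesis unfolding c'_def Suc_mult_le_cancel1 .
  qed (simp add: numeral_2_eq_2)
qed simp

lemma central_binomial_square_ge: "0 < n \<Longrightarrow> 4 ^ n \<le> 4 * n * (n choose (n div 2))\<^sup>2"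
proof (cases "even n")
  case True
  assume "0 < n"
  then obtain m where m: "n = 2 * m" "0 < m" using True by (auto elim: evenE)
  have "4 ^ n = (16 :: nat) ^ m" by (simp add: m power_mult)
  also have "\<dots> \<le> 4 * m * (2 * m choose m)\<^sup>2" by (rule central_binomial_square_ge_even[OF m(2)])
  also have "\<dots> \<le> 4 * n * (n choose (n div 2))\<^sup>2" by (simp add: m)
  finally show ?thesis .
next
  case False
  then obtain m where m: "n = 2 * m + 1" by (auto elim: oddE)
  have "4 * 4 ^ n = (16 :: nat) ^ Suc m" by (simp add: m power_mult)
  also have "\<dots> \<le> 4 * Suc m * (2 * Suc m choose Suc m)\<^sup>2"
    by (rule central_binomial_square_ge_even) simp
  also have "(2 * Suc m choose Suc m) = 2 * (n choose (n div 2))"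
    using central_binomial_odd[of n] by (simp add: m)
  also have "4 * Suc m * (2 * (n choose (n div 2)))\<^sup>2 \<le> 4 * (4 * n * (n choose (n div 2))\<^sup>2)"
    by (simp add: m power_mult_distrib)
  finally show ?thesis by simp
qed

lemma power_2_le_central_binomial:
  assumes "0 < n"
  shows "2 ^ n \<le> 2 * sqrt n * (n choose (n div 2))"
proof (rule power2_le_imp_le)
  have "(2 ^ n)\<^sup>2 = real (4 ^ n)" by (simp add: power2_eq_square flip: power_mult_distrib)
  also have "\<dots> \<le> real (4 * n * (n choose (n div 2))\<^sup>2)"
    using central_binomial_square_ge[OF assms] by (simp only: of_nat_le_iff)
  also have "\<dots> = (2 * sqrt n * (n choose (n div 2)))\<^sup>2" by (simp add: power_mult_distrib)
  finally show "(2 ^ n)\<^sup>2 \<le> (2 * sqrt n * (n choose (n div 2)))\<^sup>2" .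
qed simp

text \<open>An upset containing \<open>{}\<close> is all of \<open>Pow S\<close>, so only this one
  is left out. Superlevel sets of quilts avoid \<open>{}\<close> because quilts vanish
  there.\<close>

definition proper_upsets :: "'a set \<Rightarrow> 'a set set set" where
  "proper_upsets S = {U. U \<subseteq> Pow S - {{}} \<and> (\<forall>A\<in>U. \<forall>B\<in>Pow S. A \<subseteq> B \<longrightarrow> B \<in> U)}"

abbreviation comparable :: "'a set \<Rightarrow> 'a set \<Rightarrow> bool" where
  "comparable A B \<equiv> A \<subset> B \<or> B \<subset> A"

lemma card_proper_upsets_le_power:
  assumes "finite S"
  shows "card (proper_upsets S) \<le> 2 ^ (2 ^ card S - 1)"
proof -
  have "card (proper_upsets S) \<le> card (Pow (Pow S - {{}}))"
    by (rule card_mono) (use assms in \<open>auto simp: proper_upsets_def\<close>)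
  also have "\<dots> = 2 ^ (2 ^ card S - 1)" using assms by (simp add: card_Pow)
  finally show ?thesis .
qed

text \<open>An upset is determined by its minimal elements, apart from the question whether it contains \<open>S\<close>.\<close>

lemma card_proper_upsets_le_indep_sets:
  assumes "finite S"
  shows "card (proper_upsets S) \<le> 2 * card (indep_sets comparable (Pow S - {{}, S}))"
proof -
  \<comment> \<open>\<open>S\<close> is not a vertex of the graph and is dropped here. Both
    \<open>{S}\<close> and the empty upset then have no minimal sets; the first component of the
    injection below tells them apart.\<close>
  define mins where "mins U = {A \<in> U - {S}. \<forall>B\<in>U. B \<subseteq> A \<longrightarrow> B = A}" for U
  let ?I = "indep_sets comparable (Pow S - {{}, S})"
  have mins: "mins U \<in> ?I" if "U \<in> proper_upsets S" for U
    using that unfolding mins_def indep_sets_def proper_upsets_def by blast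
  have gen: "U - {S} = {B \<in> Pow S - {S}. \<exists>A\<in>mins U. A \<subseteq> B}" if U: "U \<in> proper_upsets S" for U
  proof (intro set_eqI iffI)
    fix B assume B: "B \<in> U - {S}"
    have "U \<subseteq> Pow S" using U unfolding proper_upsets_def by blast
    then have "finite U" using finite_subset assms by (metis finite_Pow_iff)
    then obtain A where A: "A \<in> U" "A \<subseteq> B" "\<And>B. B \<in> U \<Longrightarrow> B \<subseteq> A \<Longrightarrow> B = A"
      using finite_has_minimal2[of U B] B by (metis DiffD1)
    moreover have "B \<subset> S" using B U unfolding proper_upsets_def by blast
    ultimately show "B \<in> {B \<in> Pow S - {S}. \<exists>A\<in>mins U. A \<subseteq> B}"
      unfolding mins_def by blast
  next
    fix B assume "B \<in> {B \<in> Pow S - {S}. \<exists>A\<in>mins U. A \<subseteq> B}"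
    then show "B \<in> U - {S}" using U unfolding mins_def proper_upsets_def by blast
  qed
  have "inj_on (\<lambda>U. (S \<in> U, mins U)) (proper_upsets S)"
  proof (rule inj_onI)
    fix U U' assume U: "U \<in> proper_upsets S" "U' \<in> proper_upsets S"
      and eq: "(S \<in> U, mins U) = (S \<in> U', mins U')"
    have "U - {S} = U' - {S}" using gen[OF U(1)] gen[OF U(2)] eq by simp
    then show "U = U'" using eq by blast
  qed
  moreover have "(\<lambda>U. (S \<in> U, mins U)) ` proper_upsets S \<subseteq> UNIV \<times> ?I" using mins by auto
  moreover have "finite ((UNIV :: bool set) \<times> ?I)" using assms by (simp add: finite_indep_sets)
  ultimately have "card (proper_upsets S) \<le> card ((UNIV :: bool set) \<times> ?I)"
    by (rule card_inj_on_le)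
  then show ?thesis by (simp add: card_cartesian_product)
qed

text \<open>With \<open>x = 2 * D / card S \<le> 1 / 2\<close>, the bound \<open>C / (1 - x)\<close>
  for families of small degree is at most \<open>C * (1 + 2 * x)\<close>, so a family larger than
  that has a vertex of large degree.\<close>

lemma ex_many_comparable:
  fixes D :: real
  assumes "finite S" "S \<noteq> {}" "A \<subseteq> Pow S - {{}, S}" "0 < D" "4 * D \<le> card S"
    and "(card S choose (card S div 2)) * (1 + 4 * D / card S) < card A"
  shows "\<exists>v\<in>A. D \<le> card {w \<in> A. comparable v w}"
proof (rule ccontr)
  assume "\<not> (\<exists>v\<in>A. D \<le> card {w \<in> A. comparable v w})"
  then have deg: "card {w \<in> A. comparable v w} \<le> D" if "v \<in> A" for v
    using that by (auto simp: not_le intro: less_imp_le)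
  define x C where "x = 2 * D / card S" and "C = real (card S choose (card S div 2))"
  have "0 < card S" using assms by (simp add: card_gt_0_iff)
  then have x: "0 \<le> x" "2 * x \<le> 1" using assms(4,5) by (simp_all add: x_def field_simps)
  have "C * 1 \<le> C * ((1 + 2 * x) * (1 - x))"
  proof (rule mult_left_mono)
    have "0 \<le> x * (1 - 2 * x)" using x by (intro mult_nonneg_nonneg) auto
    then show "1 \<le> (1 + 2 * x) * (1 - x)" by (simp add: algebra_simps)
  qed (simp add: C_def)
  also have "\<dots> < card A * (1 - x)"
    using assms(6) x by (simp add: mult.assoc[symmetric] C_def x_def)
  also have "\<dots> \<le> C"
    using card_mult_le_central_binomial[OF assms(1,3) _ assms(2) deg] assms(4,5)
    by (simp add: C_def x_def)
  finally show False by simp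
qed

text \<open>This admits the rate \<open>u = ln D / D\<close> in the branching bound:
  \<open>exp (- u * D) = 1 / D\<close>, and \<open>exp u \<ge> 1 + u \<ge> 1 + 1 / D\<close> because
  \<open>D \<ge> 4\<close> gives \<open>ln D \<ge> 1\<close>.\<close>

lemma one_plus_exp_le_exp:
  fixes D :: real
  assumes "4 \<le> D"
  shows "1 + exp (- (ln D / D) * D) \<le> exp (ln D / D)"
proof -
  have "exp 1 \<le> D" using exp_le assms by linarith
  then have "1 \<le> ln D" using assms by (simp add: ln_ge_iff)
  then have "1 / D \<le> ln D / D" using assms by (intro divide_right_mono) auto
  also have "1 + \<dots> \<le> exp (ln D / D)" by (rule exp_ge_add_one_self)
  finally show ?thesis using assms by (simp add: exp_minus inverse_eq_divide)
qed

lemma half_le_ln_2: "1 / 2 \<le> ln (2 :: real)"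
proof -
  have "1 \<le> ln (2 ^ 2 :: real)" using exp_le by (subst ln_ge_iff) auto
  moreover have "ln (2 ^ 2 :: real) = 2 * ln 2" by (subst ln_realpow) simp_all
  ultimately show ?thesis by linarith
qed

text \<open>
  The branching bound is used twice: with degree \<open>n / 4\<close> it reduces to vertex sets of size at most
  \<open>2 C\<close>, and with degree \<open>sqrt n\<close> to vertex sets of size at most \<open>(1 + 4 / sqrt n) C\<close>.  A single
  round with degree \<open>sqrt n\<close> would cost a factor \<open>exp (2 ^ n * ln n / sqrt n)\<close>, which is too much.
\<close>

lemma card_indep_sets_comparable_le:
  fixes S :: "'a set"
  defines "n \<equiv> card S"
  defines "C \<equiv> real (n choose (n div 2))"
  assumes "finite S" "16 \<le> n"
  shows "card (indep_sets comparable (Pow S - {{}, S}))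
    \<le> 2 powr (C * (1 + 4 / sqrt n + 18 * ln n / sqrt n))"
proof -
  let ?V = "Pow S - {{}, S}"
  define s where "s = sqrt n"
  have s: "4 \<le> s" "s * s = n" using \<open>16 \<le> n\<close> real_sqrt_le_mono[of 16 n] by (simp_all add: s_def)
  have "S \<noteq> {}" "0 < n" using assms by (auto simp: n_def)
  have ln_s: "ln s = ln n / 2" using \<open>0 < n\<close> by (simp add: s_def ln_sqrt)
  have C: "0 \<le> C" by (simp add: C_def)
  \<comment> \<open>Bound for vertex sets of size at most \<open>2 * C\<close>: the first factor
    counts all subsets of a set below the inner threshold \<open>C * (1 + 4 / s)\<close>, the second
    is the growth over at most \<open>2 * C\<close> vertices.\<close>
  define K where "K = 2 powr (C * (1 + 4 / s)) * exp (ln s / s * (2 * C))"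
  have sparse: "card (indep_sets comparable A) \<le> K" if A: "A \<subseteq> ?V" "card A \<le> 2 * C" for A
  proof -
    have "card (indep_sets comparable A) \<le> 2 powr (C * (1 + 4 / s)) * exp (ln s / s * card A)"
    proof (rule card_indep_sets_le_exp[where V = ?V and D = s and M = "C * (1 + 4 / s)"])
      show "\<exists>v\<in>B. s \<le> card {w \<in> B. comparable v w}"
        if "B \<subseteq> ?V" "C * (1 + 4 / s) < card B" for B
      proof (rule ex_many_comparable[OF \<open>finite S\<close> \<open>S \<noteq> {}\<close> that(1)])
        have "4 * s / n = 4 / s" using s by (simp flip: s(2))
        then show "(card S choose (card S div 2)) * (1 + 4 * s / card S) < card B"
          using that(2) by (simp add: C_def n_def)
      qed (use s in \<open>simp_all flip: n_def s(2)\<close>)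
      show "card (indep_sets comparable B) \<le> 2 powr (C * (1 + 4 / s))"
        if "B \<subseteq> ?V" "card B \<le> C * (1 + 4 / s)" for B
      proof -
        have "finite B" by (rule finite_subset[OF that(1)]) (simp add: \<open>finite S\<close>)
        then have "real (card (indep_sets comparable B)) \<le> 2 ^ card B"
          using card_indep_sets_le_power[of B comparable] by simp
        also have "\<dots> = 2 powr card B" by (simp add: powr_realpow)
        also have "\<dots> \<le> 2 powr (C * (1 + 4 / s))" using that(2) by simp
        finally show ?thesis .
      qed
    qed (use s one_plus_exp_le_exp[OF s(1)] A(1) \<open>finite S\<close> in auto)
    also have "\<dots> \<le> K"
      unfolding K_def using A(2) s
      by (intro mult_left_mono iffD2[OF exp_le_cancel_iff]) simp_all
    finally show ?thesis .
  qed
  \<comment> \<open>\<open>n / 4\<close> is the largest degree that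
    \<open>ex_many_comparable\<close> allows, and its threshold becomes \<open>2 * C\<close>. By
    \<open>16 \<le> n\<close>, both \<open>s\<close> and \<open>d\<close> reach the 4 required in
    \<open>one_plus_exp_le_exp\<close>.\<close>
  define d where "d = real n / 4"
  have d: "4 \<le> d" using \<open>16 \<le> n\<close> by (simp add: d_def)
  have "card (indep_sets comparable ?V) \<le> K * exp (ln d / d * card ?V)"
  proof (rule card_indep_sets_le_exp[where V = ?V and D = d and M = "2 * C"])
    show "\<exists>v\<in>B. d \<le> card {w \<in> B. comparable v w}" if "B \<subseteq> ?V" "2 * C < card B" for B
      by (rule ex_many_comparable[OF \<open>finite S\<close> \<open>S \<noteq> {}\<close> that(1)])
        (use that(2) \<open>0 < n\<close> in \<open>simp_all add: d_def C_def flip: n_def\<close>)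
  qed (use sparse one_plus_exp_le_exp[OF d] d \<open>finite S\<close> in \<open>auto simp: K_def\<close>)
  also have "\<dots> \<le> K * exp (8 * C * ln n / s)"
  proof -
    \<comment> \<open>The rate is at most \<open>4 * ln n / n\<close>, over at most
      \<open>2 ^ n \<le> 2 * s * C\<close> vertices.\<close>
    have "ln d / d * card ?V \<le> 4 * ln n / n * (2 * s * C)"
    proof (rule mult_mono)
      have "ln d \<le> ln n" using \<open>0 < n\<close> by (simp add: d_def)
      then show "ln d / d \<le> 4 * ln n / n" using \<open>0 < n\<close> by (simp add: d_def divide_right_mono)
      have "card ?V \<le> card (Pow S)" by (rule card_mono) (use \<open>finite S\<close> in auto)
      also have "\<dots> = 2 ^ n" using \<open>finite S\<close> by (simp add: n_def card_Pow)
      finally have "real (card ?V) \<le> 2 ^ n" by simp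
      also have "\<dots> \<le> 2 * s * C"
        using power_2_le_central_binomial[OF \<open>0 < n\<close>] by (simp add: s_def C_def)
      finally show "real (card ?V) \<le> 2 * s * C" .
    qed (use \<open>0 < n\<close> in auto)
    also have "4 * ln n / n * (2 * s * C) = 8 * C * ln n / s"
      using s by (simp flip: s(2))
    finally show ?thesis by (simp add: K_def)
  qed
  \<comment> \<open>Since \<open>ln s = ln n / 2\<close>, \<open>K\<close> adds one more
    \<open>C * ln n / s\<close> to the 8 above. Passing to base 2 then turns 9 into 18, by
    \<open>2 * ln 2 \<ge> 1\<close>.\<close>
  also have "\<dots> = 2 powr (C * (1 + 4 / s)) * exp (9 * C * ln n / s)"
    by (simp add: K_def ln_s mult.assoc flip: exp_add)
  also have "\<dots> \<le> 2 powr (C * (1 + 4 / s)) * 2 powr (18 * C * ln n / s)"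
  proof (rule mult_left_mono)
    have "0 \<le> C * ln n / s" using C s \<open>0 < n\<close> by simp
    then have "9 * (C * ln n / s) * 1 \<le> 9 * (C * ln n / s) * (2 * ln 2)"
      using half_le_ln_2 by (intro mult_left_mono) auto
    then show "exp (9 * C * ln n / s) \<le> 2 powr (18 * C * ln n / s)" by (simp add: powr_def)
  qed simp
  also have "\<dots> = 2 powr (C * (1 + 4 / s + 18 * ln n / s))"
    by (simp add: algebra_simps flip: powr_add)
  finally show ?thesis by (simp add: s_def)
qed

text \<open>From \<open>n = 16\<close> on, \<open>C / sqrt n\<close> and \<open>ln n\<close> are at
  least 1, so all error terms merge into at most \<open>23 * C * ln n / sqrt n\<close>. For smaller
  \<open>n\<close> the trivial count of families without \<open>{}\<close> suffices; the larger
  constant 64 serves this case.\<close>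

lemma card_proper_upsets_le:
  fixes S :: "'a set"
  defines "n \<equiv> card S"
  assumes "finite S" "1 \<le> n"
  shows "card (proper_upsets S)
    \<le> 2 powr ((1 + 64 * ln n / sqrt n) * (n choose (n div 2)))"
proof -
  define C where "C = real (n choose (n div 2))"
  have C: "0 \<le> C" by (simp add: C_def)
  show ?thesis
  proof (cases "16 \<le> n")
    case True
    have "1 \<le> ln (real n)" using exp_le True by (subst ln_ge_iff) auto
    have "sqrt n \<le> n" using True real_sqrt_le_mono[of n "n * n"] by simp
    also have "n \<le> C" unfolding C_def using le_binomial[of "n div 2" n] True by simp
    finally have one: "1 \<le> C / sqrt n" using True by (simp add: field_simps)
    have "real (card (proper_upsets S)) \<le> 2 * card (indep_sets comparable (Pow S - {{}, S}))"
      using of_nat_mono[OF card_proper_upsets_le_indep_sets[OF \<open>finite S\<close>], where 'a = real] by simp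
    also have "\<dots> \<le> 2 * 2 powr (C * (1 + 4 / sqrt n + 18 * ln n / sqrt n))"
      using card_indep_sets_comparable_le[OF \<open>finite S\<close>] True unfolding n_def C_def by simp
    also have "\<dots> = 2 powr (1 + C * (1 + 4 / sqrt n + 18 * ln n / sqrt n))"
      by (simp add: powr_add)
    also have "\<dots> \<le> 2 powr ((1 + 64 * ln n / sqrt n) * C)"
    proof -
      define q where "q = C / sqrt n"
      have "q * 1 \<le> q * ln n"
        using one \<open>1 \<le> ln n\<close> by (intro mult_left_mono) (auto simp: q_def)
      then have *: "q \<le> q * ln n" by simp
      have "1 + C * (1 + 4 / sqrt n + 18 * ln n / sqrt n) = 1 + C + 4 * q + 18 * (q * ln n)"
        by (simp add: q_def algebra_simps)
      also have "\<dots> \<le> C + 64 * (q * ln n)" using one * unfolding q_def[symmetric] by linarith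
      also have "\<dots> = (1 + 64 * ln n / sqrt n) * C" by (simp add: q_def algebra_simps)
      finally have "1 + C * (1 + 4 / sqrt n + 18 * ln n / sqrt n) \<le> (1 + 64 * ln n / sqrt n) * C" .
      then show ?thesis by simp
    qed
    finally show ?thesis by (simp add: C_def)
  next
    case False
    have "real (card (proper_upsets S)) \<le> 2 ^ (2 ^ n - 1)"
      using card_proper_upsets_le_power[OF \<open>finite S\<close>] by (simp add: n_def)
    also have "\<dots> = 2 powr real (2 ^ n - 1)" by (simp only: powr_realpow zero_less_numeral)
    also have "\<dots> \<le> 2 powr ((1 + 64 * ln n / sqrt n) * C)"
    proof (cases "n = 1")
      \<comment> \<open>The logarithm vanishes and both exponents equal 1, so it matters that proper
        upsets omit \<open>{}\<close>.\<close>
      case True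
      then show ?thesis by (simp add: C_def)
    next
      case n: False
      have "ln 2 \<le> ln (real n)" using n \<open>1 \<le> n\<close> by (subst ln_le_cancel_iff) auto
      \<comment> \<open>Here \<open>n \<le> 15\<close>, so \<open>2 * n \<le> 30\<close>, while
        \<open>64 * ln 2 \<ge> 32\<close>.\<close>
      then have "2 * real n \<le> 64 * ln n" using half_le_ln_2 False by linarith
      then have "2 * real n / sqrt n \<le> 64 * ln n / sqrt n" by (intro divide_right_mono) auto
      moreover have "2 * real n / sqrt n = 2 * sqrt n"
        by (simp add: real_div_sqrt flip: times_divide_eq_right)
      ultimately have "2 * sqrt n * C \<le> (1 + 64 * ln n / sqrt n) * C"
        using C by (intro mult_right_mono) auto
      moreover have "real (2 ^ n - 1) \<le> 2 ^ n" by simp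
      moreover have "2 ^ n \<le> 2 * sqrt n * C"
        unfolding C_def by (rule power_2_le_central_binomial) (use \<open>1 \<le> n\<close> in simp)
      ultimately have "real (2 ^ n - 1) \<le> (1 + 64 * ln n / sqrt n) * C" by linarith
      then show ?thesis by simp
    qed
    finally show ?thesis by (simp add: C_def)
  qed
qed

section \<open>Counting quilts\<close>

text \<open>
  \<open>unit_steps m i\<close> is a sum of \<open>i\<close> unit steps at consecutive levels \<open>l\<close>, for \<open>i \<ge> 2\<close> among them the
  levels \<open>m\<close> and \<open>m + 1\<close>.  The two choices for the single step when \<open>i = 1\<close> are thus both compatible
  with \<open>i = 2\<close>.  Subtraction is truncated: near the top rank the steps start at level 1.
\<close>

definition unit_steps :: "nat \<Rightarrow> nat \<Rightarrow> nat \<Rightarrow> bool \<Rightarrow> nat" where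
  "unit_steps m i l b = min i (l - (m + 1 - i)) + of_bool (i = 1 \<and> b)"

text \<open>At level \<open>m\<close> the ranks 0, 1 and 2 get the values 0,
  \<open>of_bool b\<close> and 1; the last needs \<open>1 \<le> m\<close>. Without \<open>b\<close>,
  one more step is added below the others, which changes the count by at most one.\<close>

lemma unit_steps_Suc_rank:
  assumes "b \<Longrightarrow> l = m" "1 \<le> m"
  shows "unit_steps m (i + 1) l b \<in> {unit_steps m i l b, unit_steps m i l b + 1}"
proof (cases b)
  case True
  then have "l = m" using assms by simp
  then show ?thesis using assms(2) by (cases "i = 0"; cases "i = 1") (auto simp: unit_steps_def)
next
  case False
  have "min (i + 1) (l - (m - i)) = min i (l - (m + 1 - i)) \<or>
      min (i + 1) (l - (m - i)) = min i (l - (m + 1 - i)) + 1"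
    by arith
  then show ?thesis using False by (simp add: unit_steps_def)
qed

lemma unit_steps_Suc_level:
  assumes "b \<Longrightarrow> l = m" "b' \<Longrightarrow> l + 1 = m"
  shows "unit_steps m i (l + 1) b' \<in> {unit_steps m i l b, unit_steps m i l b + 1}"
proof (cases "i = 1 \<and> (b \<or> b')")
  case True
  then show ?thesis using assms by (auto simp: unit_steps_def)
next
  case False
  have "min i (l + 1 - k) = min i (l - k) \<or> min i (l + 1 - k) = min i (l - k) + 1" for k
    by arith
  from this[of "m + 1 - i"] show ?thesis using False by (auto simp: unit_steps_def)
qed

context graded
begin

section \<open>Upper bounds: quilts as families of upsets\<close>

lemma quilt_le_rank:
  assumes "f \<in> quilts P Q" "x \<in> P" "y \<in> Q"
  shows "f (x, y) \<le> r x"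
proof (rule le_rank[where g = "\<lambda>x. f (x, y)"])
  fix x x' assume "covered_by P x x'"
  then have "f (x', y) \<in> {f (x, y), f (x, y) + 1}"
    using covered_by_Times_left[OF _ assms(3)] assms(1) unfolding quilts_def by blast
  then show "f (x', y) \<le> f (x, y) + 1" by auto
next
  show "f (z, y) = 0" using assms z_in by (simp add: quilts_def bot_eq)
qed (rule assms(2))

lemma quilt_superlevel_proper_upset:
  assumes "f \<in> quilts P (boolean_lattice n)" "x \<in> P" "1 \<le> i"
  shows "{y \<in> boolean_lattice n. i \<le> f (x, y)} \<in> proper_upsets {1..n}"
proof -
  interpret B: graded "boolean_lattice n" "\<lambda>A. if A \<subseteq> {1..n} then card A else 0" "{}" "{1..n}"
    by (rule graded_boolean_lattice)
  have mono: "f (x, y) \<le> f (x, y')"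
    if "y \<in> boolean_lattice n" "y' \<in> boolean_lattice n" "y \<subseteq> y'" for y y'
  proof (rule B.cover_mono[where g = "\<lambda>y. f (x, y)", OF _ that])
    fix y y' assume "covered_by (boolean_lattice n) y y'"
    then have "f (x, y') \<in> {f (x, y), f (x, y) + 1}"
      using covered_by_Times_right[OF _ assms(2)] assms(1) unfolding quilts_def by blast
    then show "f (x, y) \<le> f (x, y')" by auto
  qed
  have "f (x, {}) = 0" using assms B.z_in by (simp add: quilts_def B.bot_eq)
  then have "{y \<in> boolean_lattice n. i \<le> f (x, y)} \<subseteq> Pow {1..n} - {{}}"
    using assms(3) by (auto simp: boolean_lattice_def)
  moreover have "y' \<in> {y \<in> boolean_lattice n. i \<le> f (x, y)}"
    if "y \<in> {y \<in> boolean_lattice n. i \<le> f (x, y)}" "y' \<in> Pow {1..n}" "y \<subseteq> y'" for y y'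
    using mono[of y y'] that by (auto simp: boolean_lattice_def)
  ultimately show ?thesis unfolding proper_upsets_def by blast
qed

text \<open>A quilt is determined by its superlevel sets \<open>{y. i \<le> f (x, y)}\<close> for \<open>x \<in> P\<close> and \<open>1 \<le> i \<le> rank x\<close>.\<close>

lemma quilts_bound:
  "finite (quilts P (boolean_lattice n)) \<and>
    card (quilts P (boolean_lattice n)) \<le> card (proper_upsets {1..n}) ^ rank_sum P"
proof -
  let ?Q = "quilts P (boolean_lattice n)"
  let ?I = "Sigma P (\<lambda>x. {1..r x})"
  let ?T = "?I \<rightarrow>\<^sub>E proper_upsets {1..n}"
  define \<Phi> where "\<Phi> f = restrict (\<lambda>(x, i). {y \<in> boolean_lattice n. i \<le> f (x, y)}) ?I"
    for f :: "'a \<times> nat set \<Rightarrow> nat"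
  have finI: "finite ?I" using finite by blast
  have "finite (proper_upsets {1..n})"
    by (rule finite_subset[of _ "Pow (Pow {1..n})"]) (auto simp: proper_upsets_def)
  then have finT: "finite ?T" using finI by (intro finite_PiE) auto
  have inj: "inj_on \<Phi> ?Q"
  proof (rule inj_onI)
    fix f f' assume f: "f \<in> ?Q" "f' \<in> ?Q" and eq: "\<Phi> f = \<Phi> f'"
    have ext: "f \<in> P \<times> boolean_lattice n \<rightarrow>\<^sub>E UNIV" "f' \<in> P \<times> boolean_lattice n \<rightarrow>\<^sub>E UNIV"
      using f by (simp_all add: quilts_def)
    show "f = f'"
    proof (rule PiE_ext[OF ext], clarify)
      fix x y assume xy: "x \<in> P" "y \<in> boolean_lattice n"
      have "i \<le> f (x, y) \<longleftrightarrow> i \<le> f' (x, y)" if "1 \<le> i" "i \<le> r x" for i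
      proof -
        have "\<Phi> f (x, i) = \<Phi> f' (x, i)" by (simp only: eq)
        then show ?thesis using that xy by (auto simp: \<Phi>_def)
      qed
      \<comment> \<open>The two values themselves serve as indices and give both inequalities; 0 is
        not an admissible index, hence the case split.\<close>
      from this[of "f (x, y)"] this[of "f' (x, y)"]
      show "f (x, y) = f' (x, y)"
        using quilt_le_rank[OF f(1) xy] quilt_le_rank[OF f(2) xy]
        by (cases "f (x, y) = 0"; cases "f' (x, y) = 0") auto
    qed
  qed
  have sub: "\<Phi> ` ?Q \<subseteq> ?T"
    unfolding \<Phi>_def image_subset_iff restrict_PiE_iff
    using quilt_superlevel_proper_upset by auto
  have "card ?T = card (proper_upsets {1..n}) ^ card ?I"
    using finI by (simp add: card_PiE)
  also have "card ?I = rank_sum P"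
    using finite by (simp add: rank_sum_def elem_rank_eq card_SigmaI)
  finally show ?thesis
    using inj_on_finite[OF inj sub finT] card_inj_on_le[OF inj sub finT] by simp
qed

lemma card_quilts_le:
  assumes "1 \<le> n"
  shows "card (quilts P (boolean_lattice n))
    \<le> 2 powr (rank_sum P * (1 + 64 * ln n / sqrt n) * (n choose (n div 2)))"
proof -
  let ?e = "(1 + 64 * ln n / sqrt n) * (n choose (n div 2))"
  have "real (card (quilts P (boolean_lattice n))) \<le> real (card (proper_upsets {1..n}) ^ rank_sum P)"
    using quilts_bound[of n] by (simp only: of_nat_le_iff)
  also have "\<dots> = real (card (proper_upsets {1..n})) ^ rank_sum P" by simp
  also have "\<dots> \<le> (2 powr ?e) ^ rank_sum P"
    using card_proper_upsets_le[of "{1..n}"] assms by (intro power_mono) auto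
  also have "\<dots> = 2 powr (rank_sum P * ?e)" by (simp add: powr_power)
  finally show ?thesis by (simp only: mult.assoc)
qed

section \<open>Lower bounds: quilts with free values on the middle layer\<close>

lemma restrict_in_quilts:
  assumes P_step: "\<And>x x' y. covered_by P x x' \<Longrightarrow> x \<in> P \<Longrightarrow> x' \<in> P \<Longrightarrow> r x' = r x + 1 \<Longrightarrow>
      y \<subseteq> {1..n} \<Longrightarrow> g x' y \<in> {g x y, g x y + 1}"
    and B_step: "\<And>x y y'. x \<in> P \<Longrightarrow> y \<subseteq> {1..n} \<Longrightarrow> y' \<subseteq> {1..n} \<Longrightarrow> card y' = card y + 1 \<Longrightarrow>
      g x y' \<in> {g x y, g x y + 1}"
    and zero: "\<And>y. y \<subseteq> {1..n} \<Longrightarrow> g z y = 0" "\<And>x. x \<in> P \<Longrightarrow> g x {} = 0"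
    and top: "g t {1..n} = min (r t) n"
  shows "restrict (\<lambda>(x, y). g x y) (P \<times> boolean_lattice n) \<in> quilts P (boolean_lattice n)"
proof -
  interpret B: graded "boolean_lattice n" "\<lambda>A. if A \<subseteq> {1..n} then card A else 0" "{}" "{1..n}"
    by (rule graded_boolean_lattice)
  define f where "f = restrict (\<lambda>(x, y). g x y) (P \<times> boolean_lattice n)"
  \<comment> \<open>A cover in the product moves one coordinate only, hence the two separate step
    hypotheses.\<close>
  have f_step: "f q \<in> {f p, f p + 1}" if "covered_by (P \<times> boolean_lattice n) p q" for p q
    using that
  proof (cases rule: covered_by_Times)
    case (left x x' y)
    then have "x \<in> P" "x' \<in> P" "y \<subseteq> {1..n}" by (auto simp: covered_by_def boolean_lattice_def)
    then show ?thesis using P_step[OF left(3)] rank_cover[OF left(3)] left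
      by (auto simp: boolean_lattice_def f_def)
  next
    case (right x y y')
    then have "y \<subseteq> {1..n}" "y' \<subseteq> {1..n}" by (auto simp: covered_by_def boolean_lattice_def)
    then show ?thesis using B_step[OF right(4), of y y'] B.rank_cover[OF right(3)] right
      by (auto simp: boolean_lattice_def f_def)
  qed
  have f_zero: "f (x, y) = 0" if "x \<in> P" "y \<in> boolean_lattice n" "x = z \<or> y = {}" for x y
    using that zero by (auto simp: boolean_lattice_def f_def)
  have f_top: "f (t, {1..n}) = min (r t) n" using top t_in B.t_in by (simp add: f_def)
  have f_ext: "f \<in> P \<times> boolean_lattice n \<rightarrow>\<^sub>E UNIV" by (simp add: f_def)
  have "f \<in> quilts P (boolean_lattice n)"
    unfolding quilts_def bot_eq B.bot_eq top_eq B.top_eq poset_rank_eq B.poset_rank_eq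
    by (intro CollectI conjI ballI allI impI f_ext f_zero f_step) (simp_all add: f_top[simplified])
  then show ?thesis by (simp only: f_def)
qed

text \<open>Each family \<open>T\<close> of middle-layer sets yields a quilt, and \<open>T\<close>
  can be read off at an element of rank 1, which exists by \<open>1 \<le> r t\<close>. The bound
  \<open>r t \<le> n\<close> lets the quilt reach \<open>r t\<close> at the top, and
  \<open>2 \<le> n\<close> keeps \<open>{}\<close> off the middle layer.\<close>

lemma two_power_le_card_quilts:
  assumes "1 \<le> r t" "r t \<le> n" "2 \<le> n"
  shows "2 ^ (n choose (n div 2)) \<le> card (quilts P (boolean_lattice n))"
proof -
  define m where "m = n div 2"
  have m: "1 \<le> m" "m < n" using assms(3) by (auto simp: m_def)
  define L where "L = {A. A \<subseteq> {1..n} \<and> card A = m}"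
  define g where "g T x y = unit_steps m (r x) (card y) (y \<in> T)" for T x and y :: "nat set"
  define q where "q T = restrict (\<lambda>(x, y). g T x y) (P \<times> boolean_lattice n)" for T
  obtain a where a: "a \<in> P" "r a = 1" using ex_rank_1[OF assms(1)] by blast
  have "q T \<in> quilts P (boolean_lattice n)" if "T \<in> Pow L" for T
    unfolding q_def
  proof (rule restrict_in_quilts)
    have T: "card y = m" if "y \<in> T" for y using \<open>T \<in> Pow L\<close> that by (auto simp: L_def)
    show "g T x' y \<in> {g T x y, g T x y + 1}" if "r x' = r x + 1" for x x' y
      unfolding g_def that by (rule unit_steps_Suc_rank[OF T m(1)])
    show "g T x y' \<in> {g T x y, g T x y + 1}" if "card y' = card y + 1" for x y y'
      unfolding g_def that by (rule unit_steps_Suc_level) (use T that in auto)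
    show "g T z y = 0" for y by (simp add: g_def unit_steps_def rank_z)
    show "g T x {} = 0" for x using T[of "{}"] m by (auto simp: g_def unit_steps_def)
    show "g T t {1..n} = min (r t) n" using T[of "{1..n}"] m assms by (auto simp: g_def unit_steps_def)
  qed
  then have "q ` Pow L \<subseteq> quilts P (boolean_lattice n)" by blast
  moreover have "inj_on q (Pow L)"
  proof (rule inj_onI)
    fix T T' assume T: "T \<in> Pow L" "T' \<in> Pow L" and eq: "q T = q T'"
    have "y \<in> T \<longleftrightarrow> y \<in> T'" if "y \<in> L" for y
    proof -
      have "q U (a, y) = of_bool (y \<in> U)" for U
        using a that by (simp add: q_def g_def unit_steps_def L_def boolean_lattice_def)
      from this[of T] this[of T'] have "of_bool (y \<in> T) = (of_bool (y \<in> T') :: nat)"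
        unfolding eq by (rule trans[OF sym])
      then show ?thesis by (simp only: of_bool_eq_iff)
    qed
    then show "T = T'" using T by blast
  qed
  ultimately have "card (Pow L) \<le> card (quilts P (boolean_lattice n))"
    using quilts_bound[of n] by (intro card_inj_on_le) auto
  moreover have "card L = n choose m" unfolding L_def using n_subsets[of "{1..n}" m] by simp
  moreover have "finite L" unfolding L_def by (rule finite_subset[of _ "Pow {1..n}"]) auto
  ultimately show ?thesis by (simp add: card_Pow m_def)
qed

text \<open>
  Below level \<open>m\<close> the quilt is 0 and at level \<open>m + j\<close> it is \<open>min (rank x) j\<close>; at level \<open>m\<close> any
  choice of maps counted by \<open>d1\<close> fits in between.
\<close>

lemma d1_power_le_card_quilts:
  assumes "1 \<le> n" "2 * r t \<le> n"
  shows "d1 P ^ (n choose (n div 2)) \<le> card (quilts P (boolean_lattice n))"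
proof -
  define D where "D = {f \<in> P \<rightarrow>\<^sub>E {0, 1 :: nat}.
    f ` P = {0, 1} \<and> (\<forall>x y. covered_by P x y \<longrightarrow> f y \<in> {f x, f x + 1})}"
  have d1: "d1 P = card D" by (simp add: d1_def D_def)
  have D: "p x \<in> {0, 1}" if "p \<in> D" "x \<in> P" for p x
    using that unfolding D_def by auto
  have D_step: "p x' \<in> {p x, p x + 1}" if "p \<in> D" "covered_by P x x'" for p x x'
    using that unfolding D_def by blast
  \<comment> \<open>Surjectivity provides the value 0 somewhere, and monotonicity carries it down to
    \<open>z\<close>.\<close>
  have D_z: "p z = 0" if "p \<in> D" for p
  proof -
    have "0 \<in> p ` P" using that unfolding D_def by blast
    then obtain x where x: "x \<in> P" "p x = 0" by force
    have "p z \<le> p x"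
    proof (rule cover_mono[OF _ z_in x(1) z_le[OF x(1)]])
      show "p v \<le> p w" if "covered_by P v w" for v w using D_step[OF \<open>p \<in> D\<close> that] by auto
    qed
    then show ?thesis using x by simp
  qed
  have D_rank: "p x \<le> r x" if "p \<in> D" "x \<in> P" for p x
    using D[OF that] D_z[OF that(1)] rank_pos[OF that(2)] by (cases "x = z") auto
  show ?thesis
  proof (cases "D = {}")
    case True
    then show ?thesis by (simp add: d1 power_0_left)
  next
    case False
    then obtain p where p: "p \<in> D" by blast
    then have "1 \<in> p ` P" unfolding D_def by blast
    then obtain x where "x \<in> P" "p x = 1" by force
    then have rt: "1 \<le> r t" using D_rank[OF p] rank_mono[of x t] le_t t_in by fastforce
    define m where "m = n div 2"
    \<comment> \<open>At least \<open>r t\<close> levels lie above \<open>m\<close>, so the quilt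
      can climb to \<open>r t\<close> at the top; \<open>1 \<le> m\<close> keeps \<open>{}\<close>
      out of \<open>L\<close>.\<close>
    have m: "1 \<le> m" "m < n" "r t \<le> n - m" using assms rt by (auto simp: m_def)
    define L where "L = {A. A \<subseteq> {1..n} \<and> card A = m}"
    have finL: "finite L" unfolding L_def by (rule finite_subset[of _ "Pow {1..n}"]) auto
    define g where "g \<phi> x y = min (r x) (card y - m) + (if y \<in> L then \<phi> y x else 0)"
      for \<phi> :: "nat set \<Rightarrow> 'a \<Rightarrow> nat" and x y
    define q where "q \<phi> = restrict (\<lambda>(x, y). g \<phi> x y) (P \<times> boolean_lattice n)" for \<phi>
    have "q \<phi> \<in> quilts P (boolean_lattice n)" if \<phi>: "\<phi> \<in> L \<rightarrow>\<^sub>E D" for \<phi>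
      unfolding q_def
    proof (rule restrict_in_quilts)
      have \<phi>_D: "\<phi> y \<in> D" if "y \<in> L" for y using \<phi> that by auto
      show "g \<phi> x' y \<in> {g \<phi> x y, g \<phi> x y + 1}"
        if "covered_by P x x'" "r x' = r x + 1" for x x' y
        using D_step[OF \<phi>_D that(1), of y] that(2) by (auto simp: g_def L_def)
      show "g \<phi> x y' \<in> {g \<phi> x y, g \<phi> x y + 1}"
        if "x \<in> P" "y \<subseteq> {1..n}" "y' \<subseteq> {1..n}" "card y' = card y + 1" for x y y'
      proof -
        have "y \<in> L \<longleftrightarrow> card y = m" "y' \<in> L \<longleftrightarrow> card y' = m" using that by (auto simp: L_def)
        then consider "y \<in> L" "card y = m" "y' \<notin> L" | "y' \<in> L" "card y' = m" "y \<notin> L"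
          | "y \<notin> L" "y' \<notin> L" "card y \<noteq> m"
          using \<open>card y' = card y + 1\<close> by (cases "card y = m"; cases "card y' = m") auto
        then show ?thesis
        proof cases
          \<comment> \<open>Going up from the middle layer, \<open>\<phi> y x\<close> is 1 only
            where \<open>r x \<ge> 1\<close>, so it does not exceed the next value
            \<open>min (r x) 1\<close>.\<close>
          case 1
          then show ?thesis
            using D[OF \<phi>_D, of y x] D_rank[OF \<phi>_D, of y x] that by (auto simp: g_def)
        next
          case 2
          then show ?thesis using D[OF \<phi>_D, of y' x] that by (auto simp: g_def)
        qed (use that in \<open>auto simp: g_def\<close>)
      qed
      show "g \<phi> z y = 0" for y using D_z[OF \<phi>_D] by (simp add: g_def rank_z)
      show "g \<phi> x {} = 0" for x using m by (simp add: g_def L_def)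
      show "g \<phi> t {1..n} = min (r t) n" using m by (simp add: g_def L_def)
    qed
    then have "q ` (L \<rightarrow>\<^sub>E D) \<subseteq> quilts P (boolean_lattice n)" by blast
    moreover have "inj_on q (L \<rightarrow>\<^sub>E D)"
    proof (rule inj_onI)
      fix \<phi> \<psi> assume \<phi>\<psi>: "\<phi> \<in> L \<rightarrow>\<^sub>E D" "\<psi> \<in> L \<rightarrow>\<^sub>E D" and eq: "q \<phi> = q \<psi>"
      show "\<phi> = \<psi>"
      proof (rule PiE_ext[OF \<phi>\<psi>])
        fix y assume y: "y \<in> L"
        then have "\<phi> y \<in> D" "\<psi> y \<in> D" using \<phi>\<psi> by auto
        then have ext: "\<phi> y \<in> P \<rightarrow>\<^sub>E {0, 1}" "\<psi> y \<in> P \<rightarrow>\<^sub>E {0, 1}"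
          unfolding D_def by simp_all
        show "\<phi> y = \<psi> y"
        proof (rule PiE_ext[OF ext])
          fix x assume x: "x \<in> P"
          have "q \<phi> (x, y) = q \<psi> (x, y)" by (simp only: eq)
          then show "\<phi> y x = \<psi> y x"
            using x y by (simp add: q_def g_def L_def boolean_lattice_def)
        qed
      qed
    qed
    ultimately have "card (L \<rightarrow>\<^sub>E D) \<le> card (quilts P (boolean_lattice n))"
      using quilts_bound[of n] by (intro card_inj_on_le) auto
    moreover have "card L = n choose m" unfolding L_def using n_subsets[of "{1..n}" m] by simp
    ultimately show ?thesis using finL by (simp add: card_PiE d1 m_def)
  qed
qed

end

text \<open>The maps are 0 below the middle layer, 1 above it and free on it.
  \<open>2 \<le> k\<close> keeps \<open>{}\<close> and \<open>{1..k}\<close> off that layer, so both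
  values occur.\<close>

lemma two_power_le_d1_boolean_lattice:
  assumes "2 \<le> k"
  shows "2 ^ (k choose (k div 2)) \<le> d1 (boolean_lattice k)"
proof -
  define m where "m = k div 2"
  have m: "1 \<le> m" "m < k" using assms by (auto simp: m_def)
  define L where "L = {A. A \<subseteq> {1..k} \<and> card A = m}"
  define D where "D = {f \<in> boolean_lattice k \<rightarrow>\<^sub>E {0, 1 :: nat}. f ` boolean_lattice k = {0, 1} \<and>
    (\<forall>x y. covered_by (boolean_lattice k) x y \<longrightarrow> f y \<in> {f x, f x + 1})}"
  define p where "p T = restrict (\<lambda>A. of_bool (m < card A \<or> A \<in> T) :: nat) (boolean_lattice k)"
    for T
  have finD: "finite D"
    by (rule finite_subset[of _ "boolean_lattice k \<rightarrow>\<^sub>E {0, 1 :: nat}"])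
      (auto simp: D_def boolean_lattice_def intro!: finite_PiE)
  have "p T \<in> D" if T: "T \<in> Pow L" for T
  proof -
    have T: "card y = m" if "y \<in> T" for y using T that by (auto simp: L_def)
    have "p T {} = 0" "p T {1..k} = 1"
      using T[of "{}"] m by (auto simp: p_def boolean_lattice_def)
    then have surj: "{0, 1} \<subseteq> p T ` boolean_lattice k"
      by (metis (no_types, lifting) boolean_lattice_def Pow_bottom Pow_top empty_subsetI imageI insert_subset)
    have range: "p T \<in> boolean_lattice k \<rightarrow>\<^sub>E {0, 1}" by (auto simp: p_def)
    have image: "p T ` boolean_lattice k = {0, 1}"
      by (rule subset_antisym[OF _ surj]) (auto simp: p_def)
    have step: "p T y \<in> {p T x, p T x + 1}" if cov: "covered_by (boolean_lattice k) x y" for x y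
    proof -
      have "card y = card x + 1" "x \<in> boolean_lattice k" "y \<in> boolean_lattice k"
        using cov covered_by_Pow_card[of "{1..k}" x y] unfolding boolean_lattice_def
        by (auto simp: covered_by_def)
      then show ?thesis using T[of x] T[of y] by (auto simp: p_def)
    qed
    show ?thesis unfolding D_def by (intro CollectI conjI allI impI range image step)
  qed
  then have "p ` Pow L \<subseteq> D" by blast
  moreover have "inj_on p (Pow L)"
  proof (rule inj_onI)
    fix T T' assume T: "T \<in> Pow L" "T' \<in> Pow L" and eq: "p T = p T'"
    have "y \<in> T \<longleftrightarrow> y \<in> T'" if "y \<in> L" for y
    proof -
      have "p U y = of_bool (y \<in> U)" for U
        using that by (simp add: p_def L_def boolean_lattice_def)
      from this[of T] this[of T'] have "of_bool (y \<in> T) = (of_bool (y \<in> T') :: nat)"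
        unfolding eq by (rule trans[OF sym])
      then show ?thesis by (simp only: of_bool_eq_iff)
    qed
    then show "T = T'" using T by blast
  qed
  ultimately have "card (Pow L) \<le> card D" using finD by (intro card_inj_on_le) auto
  moreover have "card L = k choose m" unfolding L_def using n_subsets[of "{1..k}" m] by simp
  moreover have "finite L" unfolding L_def by (rule finite_subset[of _ "Pow {1..k}"]) auto
  ultimately show ?thesis by (simp add: card_Pow m_def d1_def D_def)
qed

text \<open>Complementation pairs rank \<open>j\<close> with rank \<open>k - j\<close>, so the
  average rank is \<open>k / 2\<close>.\<close>

lemma rank_sum_boolean_lattice: "rank_sum (boolean_lattice k) = k * 2 ^ (k - 1)"
proof -
  interpret B: graded "boolean_lattice k" "\<lambda>A. if A \<subseteq> {1..k} then card A else 0" "{}" "{1..k}"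
    by (rule graded_boolean_lattice)
  have sum: "rank_sum (boolean_lattice k) = (\<Sum>A\<in>Pow {1..k}. card A)"
    unfolding rank_sum_def B.elem_rank_eq by (auto simp: boolean_lattice_def intro: sum.cong)
  also have "\<dots> = (\<Sum>A\<in>Pow {1..k}. card ({1..k} - A))"
    by (rule sum.reindex_bij_witness[of _ "\<lambda>A. {1..k} - A" "\<lambda>A. {1..k} - A"])
      (auto simp: double_diff)
  finally have "2 * rank_sum (boolean_lattice k) = (\<Sum>A\<in>Pow {1..k}. card A + card ({1..k} - A))"
    using sum by (simp add: sum.distrib)
  also have "\<dots> = (\<Sum>A\<in>Pow {1..k}. k)"
  proof (rule sum.cong[OF refl])
    fix A assume "A \<in> Pow {1..k}"
    then have "finite A" "A \<subseteq> {1..k}" by (auto intro: finite_subset)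
    then show "card A + card ({1..k} - A) = k"
      using card_Diff_subset[of A "{1..k}"] card_mono[of "{1..k}" A] by simp
  qed
  also have "\<dots> = k * 2 ^ k" by (simp add: card_Pow)
  finally show ?thesis by (cases k) auto
qed

text \<open>The first lower bound is restricted to \<open>poset_rank P \<ge> 1\<close> and
  \<open>n \<ge> 2\<close> because in the excluded cases there is only one quilt, while the bound is
  at least 2.\<close>

theorem theorem8p2:
  fixes P :: "'a::order set"
  assumes "finite_ranked_poset P"
  shows "\<exists>c::real. c > 0 \<and>
    (\<forall>n::nat. n \<ge> 1 \<and> n \<ge> poset_rank P \<longrightarrow>
       (poset_rank P \<ge> 1 \<and> n \<ge> 2 \<longrightarrow>
          2 ^ (n choose (n div 2)) \<le> card (quilts P (boolean_lattice n))) \<and>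
       real (card (quilts P (boolean_lattice n)))
         \<le> 2 powr (real (rank_sum P) * (1 + c * ln (real n) / sqrt (real n))
                     * real (n choose (n div 2)))) \<and>
    (\<forall>n::nat. n \<ge> 1 \<and> n \<ge> 2 * poset_rank P \<longrightarrow>
       d1 P ^ (n choose (n div 2)) \<le> card (quilts P (boolean_lattice n))) \<and>
    (\<forall>k n::nat. k \<ge> 1 \<and> n \<ge> 2 * k \<longrightarrow>
       2 ^ ((k choose (k div 2)) * (n choose (n div 2)))
         \<le> card (quilts (boolean_lattice k) (boolean_lattice n)) \<and>
       real (card (quilts (boolean_lattice k) (boolean_lattice n)))
         \<le> 2 powr (real (k * 2 ^ (k - 1)) * (1 + c * ln (real n) / sqrt (real n))
                     * real (n choose (n div 2))))"
proof -
  obtain r z t where "graded P r z t" using finite_ranked_poset_graded[OF assms] by blast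
  then interpret graded P r z t .
  have boolean: "2 ^ ((k choose (k div 2)) * (n choose (n div 2)))
         \<le> card (quilts (boolean_lattice k) (boolean_lattice n)) \<and>
       real (card (quilts (boolean_lattice k) (boolean_lattice n)))
         \<le> 2 powr (real (k * 2 ^ (k - 1)) * (1 + 64 * ln (real n) / sqrt (real n))
                     * real (n choose (n div 2)))"
    if kn: "1 \<le> k" "2 * k \<le> n" for k n
  proof -
    interpret B: graded "boolean_lattice k" "\<lambda>A. if A \<subseteq> {1..k} then card A else 0" "{}" "{1..k}"
      by (rule graded_boolean_lattice)
    have "2 ^ ((k choose (k div 2)) * (n choose (n div 2)))
        \<le> card (quilts (boolean_lattice k) (boolean_lattice n))"
    proof (cases "k = 1")
      \<comment> \<open>The two-element lattice has \<open>d1\<close> equal to 1, so the base 2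
        comes from the general lower bound instead.\<close>
      case True
      then show ?thesis using B.two_power_le_card_quilts[of n] kn by simp
    next
      case False
      then have "(2 ^ (k choose (k div 2))) ^ (n choose (n div 2))
          \<le> d1 (boolean_lattice k) ^ (n choose (n div 2))"
        using two_power_le_d1_boolean_lattice[of k] kn by (intro power_mono) auto
      also have "\<dots> \<le> card (quilts (boolean_lattice k) (boolean_lattice n))"
        using B.d1_power_le_card_quilts[of n] kn by simp
      finally show ?thesis by (simp add: power_mult)
    qed
    moreover have "1 \<le> n" using kn by simp
    ultimately show ?thesis using B.card_quilts_le[of n] by (simp only: rank_sum_boolean_lattice)
  qed
  show ?thesis
    using two_power_le_card_quilts card_quilts_le d1_power_le_card_quilts boolean
    by (intro exI[of _ "64 :: real"]) (simp add: poset_rank_eq)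
qed

end
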